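(* Let $S$ be an orientable hyperbolic surface. Every closed geodesic of length $\ell$ on $S$ has a stable neighborhood of width $r(\ell/2)$; that is, if $\omega$ is a (not necessarily simple) closed geodesic of length $\ell$ on $S$, then the neighborhood $U_{r(\ell/2)}(\omega)$ is stable. Furthermore, if $\omega_1$ and $\omega_2$ are two disjoint closed geodesics on $S$, of lengths $\ell_1$ and $\ell_2$ respectively, which are separated by a disjoint union of simple closed geodesics, then their stable neighborhoods $U_{r(\ell_1/2)}(\omega_1)$ and $U_{r(\ell_2/2)}(\omega_2)$ are disjoint.
   Context: A hyperbolic surface is a complete surface of constant curvature $-1$. The function $r:\mathbb{R}^+\to\mathbb{R}^+$ is $r(x)=\log\coth(x/2)$. For a geodesic $\omega$ in a hyperbolic surface (including a complete geodesic in the hyperbolic plane $\mathbb{H}^2$) and $d>0$, $U_d(\omega)$ denotes the neighborhood of width $d$ about $\omega$: the set of all points of the surface at distance less than $d$ from $\omega$. If $\omega$ is a closed geodesic, $U_d(\omega)$ is called stable if for any two connected (smooth) lifts $\tilde\omega_1,\tilde\omega_2$ of $\omega$ to the universal cover $\mathbb{H}^2$ (these are complete geodesics of $\mathbb{H}^2$) one has $$\tilde\omega_1\cap\tilde\omega_2\neq\emptyset \quad\text{if and only if}\quad U_d(\tilde\omega_1)\cap U_d(\tilde\omega_2)\neq\emptyset .$$ Two closed geodesics are separated by a disjoint union of simple closed geodesics if there is a union of pairwise disjoint simple closed geodesics such that the two given geodesics lie in different connected components of its complement in the surface. *)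

theory Defs
  imports "HOL-Analysis.Analysis"
begin

text \<open>The hyperbolic plane is the upper half-plane with the distance of the metric
  \<open>(dx\<^sup>2 + dy\<^sup>2) / y\<^sup>2\<close>; it has constant curvature -1.\<close>

definition hplane :: "complex set" where
  "hplane = {z. Im z > 0}"

definition hdist :: "complex \<Rightarrow> complex \<Rightarrow> real" where
  "hdist z w = arcosh (1 + (cmod (z - w))\<^sup>2 / (2 * Im z * Im w))"

text \<open>A surface is a subset \<open>S\<close> of a metric space, and \<open>dist\<close> on \<open>S\<close> is its Riemannian
  distance. Hence \<open>dist\<close> must be an intrinsic metric: the distance of two points is the
  infimum of the lengths of the paths in \<open>S\<close> joining them. This includes that \<open>S\<close> is
  path connected, since the infimum of the empty set is infinite.\<close>

definition curve_length :: "(real \<Rightarrow> 'a::metric_space) \<Rightarrow> ereal" where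
  "curve_length g =
     (SUP t \<in> {t. sorted t \<and> set t \<subseteq> {0..1}}.
        ereal (\<Sum>i<length t - 1. dist (g (t ! i)) (g (t ! Suc i))))"

definition length_space :: "'a::metric_space set \<Rightarrow> bool" where
  "length_space S \<longleftrightarrow>
     (\<forall>x\<in>S. \<forall>y\<in>S. ereal (dist x y) =
        (INF g \<in> {g. path g \<and> path_image g \<subseteq> S \<and> pathstart g = x \<and> pathfinish g = y}.
           curve_length g))"

text \<open>Curvature -1 means locally isometric to the hyperbolic plane.\<close>

definition hyperbolic_chart ::
    "'a::metric_space set \<Rightarrow> 'a set \<Rightarrow> ('a \<Rightarrow> complex) \<Rightarrow> bool" where
  "hyperbolic_chart S U f \<longleftrightarrow>
     openin (top_of_set S) U \<and> open (f ` U) \<and> f ` U \<subseteq> hplane \<and>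
     (\<forall>p\<in>U. \<forall>q\<in>U. hdist (f p) (f q) = dist p q)"

definition hyperbolic_surface :: "'a::metric_space set \<Rightarrow> bool" where
  "hyperbolic_surface S \<longleftrightarrow>
     S \<noteq> {} \<and> complete S \<and> length_space S \<and>
     (\<forall>p\<in>S. \<exists>U f. hyperbolic_chart S U f \<and> p \<in> U)"

text \<open>\<open>Im (cnj (D 1) * D \<i>)\<close> is the determinant of the real linear map
  \<open>D :: complex \<Rightarrow> complex\<close>. Transition maps between hyperbolic charts are isometries of
  open subsets of the hyperbolic plane, so they are automatically smooth.\<close>

definition orientation_preserving_on :: "complex set \<Rightarrow> (complex \<Rightarrow> complex) \<Rightarrow> bool" where
  "orientation_preserving_on V h \<longleftrightarrow>
     (\<forall>z\<in>V. \<exists>D. (h has_derivative D) (at z) \<and> Im (cnj (D 1) * D \<i>) > 0)"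

definition orientable_surface :: "'a::metric_space set \<Rightarrow> bool" where
  "orientable_surface S \<longleftrightarrow>
     (\<exists>\<A>. (\<forall>(U, f)\<in>\<A>. hyperbolic_chart S U f) \<and>
        (\<forall>p\<in>S. \<exists>(U, f)\<in>\<A>. p \<in> U) \<and>
        (\<forall>(U, f)\<in>\<A>. \<forall>(V, g)\<in>\<A>.
           orientation_preserving_on (f ` (U \<inter> V)) (g \<circ> inv_into U f)))"

text \<open>The metric of the universal cover is the one lifted from \<open>S\<close>, so the covering map
  is a local isometry.\<close>

definition universal_cover :: "'a::metric_space set \<Rightarrow> (complex \<Rightarrow> 'a) \<Rightarrow> bool" where
  "universal_cover S \<pi> \<longleftrightarrow>
     covering_space hplane \<pi> S \<and>
     (\<forall>z\<in>hplane. \<exists>\<epsilon>>0. \<forall>v\<in>hplane. \<forall>w\<in>hplane.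
        hdist z v < \<epsilon> \<and> hdist z w < \<epsilon> \<longrightarrow> dist (\<pi> v) (\<pi> w) = hdist v w)"

text \<open>A closed geodesic of length \<open>l\<close> is a unit speed geodesic with period \<open>l\<close>. The
  period need not be minimal: geodesics traversed several times are included.\<close>

definition closed_geodesic ::
    "'a::metric_space set \<Rightarrow> (real \<Rightarrow> 'a) \<Rightarrow> real \<Rightarrow> bool" where
  "closed_geodesic S \<omega> l \<longleftrightarrow>
     range \<omega> \<subseteq> S \<and> l > 0 \<and> (\<forall>t. \<omega> (t + l) = \<omega> t) \<and>
     (\<forall>t. \<exists>\<epsilon>>0. \<forall>s u. \<bar>s - t\<bar> < \<epsilon> \<and> \<bar>u - t\<bar> < \<epsilon> \<longrightarrow> dist (\<omega> s) (\<omega> u) = \<bar>s - u\<bar>)"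

definition simple_closed_geodesic ::
    "'a::metric_space set \<Rightarrow> (real \<Rightarrow> 'a) \<Rightarrow> real \<Rightarrow> bool" where
  "simple_closed_geodesic S \<omega> l \<longleftrightarrow> closed_geodesic S \<omega> l \<and> inj_on \<omega> {0..<l}"

text \<open>A connected lift of the curve \<open>\<omega>\<close> is the range of a lift of the parametrization to
  the whole real line.\<close>

definition connected_lift :: "(complex \<Rightarrow> 'a::metric_space) \<Rightarrow> (real \<Rightarrow> 'a) \<Rightarrow> complex set \<Rightarrow> bool"
  where
  "connected_lift \<pi> \<omega> L \<longleftrightarrow>
     (\<exists>h. continuous_on UNIV h \<and> range h \<subseteq> hplane \<and> (\<forall>t. \<pi> (h t) = \<omega> t) \<and> L = range h)"

definition nbhd :: "'b set \<Rightarrow> ('b \<Rightarrow> 'b \<Rightarrow> real) \<Rightarrow> real \<Rightarrow> 'b set \<Rightarrow> 'b set" where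
  "nbhd X \<delta> d A = {x\<in>X. \<exists>a\<in>A. \<delta> x a < d}"

definition stable_nbhd :: "(complex \<Rightarrow> 'a::metric_space) \<Rightarrow> (real \<Rightarrow> 'a) \<Rightarrow> real \<Rightarrow> bool" where
  "stable_nbhd \<pi> \<omega> d \<longleftrightarrow>
     (\<forall>L1 L2. connected_lift \<pi> \<omega> L1 \<and> connected_lift \<pi> \<omega> L2 \<longrightarrow>
        (L1 \<inter> L2 \<noteq> {} \<longleftrightarrow> nbhd hplane hdist d L1 \<inter> nbhd hplane hdist d L2 \<noteq> {}))"

definition separated_by_simple_geodesics ::
    "'a::metric_space set \<Rightarrow> (real \<Rightarrow> 'a) \<Rightarrow> (real \<Rightarrow> 'a) \<Rightarrow> bool" where
  "separated_by_simple_geodesics S \<omega>1 \<omega>2 \<longleftrightarrow>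
     (\<exists>\<Gamma>. (\<forall>C\<in>\<Gamma>. \<exists>\<gamma> l. simple_closed_geodesic S \<gamma> l \<and> C = range \<gamma>) \<and>
        pairwise disjnt \<Gamma> \<and>
        (\<exists>C1\<in>components (S - \<Union>\<Gamma>). \<exists>C2\<in>components (S - \<Union>\<Gamma>).
           C1 \<noteq> C2 \<and> range \<omega>1 \<subseteq> C1 \<and> range \<omega>2 \<subseteq> C2))"

definition collar_width :: "real \<Rightarrow> real" where
  "collar_width x = ln (cosh (x / 2) / sinh (x / 2))"

end

theory Submission
  imports Defs "HOL-Complex_Analysis.Conformal_Mappings"
begin

text \<open>The universal cover is the upper half-plane, where \<open>moeb\<close> with determinant one is an
orientation preserving isometry and every unit speed geodesic is the image of the imaginary axis,
parametrized by \<open>vert t = \<i> e\<^sup>t\<close>, under such a map. A lift of a closed geodesic of length \<open>l\<close> is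
therefore a line, and the translation by \<open>l\<close> along this line is a deck transformation of the cover
(\<open>closed_geodesic_deck_transformation\<close>). This is where orientability enters: the translation and
the true deck transformation agree on the line, so they differ at most by the reflection in it.

Nontrivial deck transformations have no fixed points, because the covering map is locally injective;
in terms of matrices, their trace has absolute value at least 2 (\<open>invariant_trace\<close>). Normalise one
lift to be the imaginary axis and let \<open>a, b, c, d\<close> be the matrix of a second, disjoint lift of the same
geodesic. The axes are not asymptotic, since otherwise a commutator of the two translations would be
parabolic and conjugation by one of them would make it arbitrarily small (\<open>not_asymptotic\<close>). Then
\<open>\<bar>a d + b c\<bar>\<close> is the hyperbolic cosine of the distance of the two axes. Composing the translation along
one axis with the translation or inverse translation along the other one, so that they nearly cancel,
gives the half trace \<open>1 - (\<bar>a d + b c\<bar> - 1) sinh\<^sup>2 (l / 2)\<close>. As this has absolute value at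
least one, the distance of the axes is at least twice the width of the collar
(\<open>equal_length_axes_far_apart\<close>), which is stability.

For the second claim, a path that starts on \<open>\<omega>\<close> and is shorter than the width of its collar cannot
meet a simple closed geodesic \<open>\<gamma>\<close> disjoint from \<open>\<omega>\<close> (\<open>short_path_avoids_simple_geodesic\<close>). Lift the
path; it joins a lift of \<open>\<omega>\<close> to a lift of \<open>\<gamma>\<close>. The translate of the latter along the former is again a
lift of \<open>\<gamma>\<close>, hence disjoint from it since \<open>\<gamma>\<close> is simple. So the projection of the lift of \<open>\<gamma>\<close> to the lift
of \<open>\<omega>\<close> has length at most \<open>l\<close>, and a geodesic with such a short shadow is far away from the axis
(\<open>disjoint_translates_far_from_axis\<close>). If the two collars had a common point, two such short paths would
join \<open>\<omega>1\<close> to \<open>\<omega>2\<close> in the complement of the separating geodesics.\<close>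

section \<open>Moebius transformations and the distance of the half-plane\<close>

text \<open>The matrix is kept as four real parameters, since the arguments below are
computations with its entries.\<close>

definition moeb :: "real \<Rightarrow> real \<Rightarrow> real \<Rightarrow> real \<Rightarrow> complex \<Rightarrow> complex" where
  "moeb a b c d z = (of_real a * z + of_real b) / (of_real c * z + of_real d)"

text \<open>The imaginary axis with its unit speed parametrization.\<close>

definition vert :: "real \<Rightarrow> complex" where
  "vert t = Complex 0 (exp t)"

lemma cosh_hdist:
  assumes "z \<in> hplane" "w \<in> hplane"
  shows "cosh (hdist z w) = 1 + (cmod (z - w))\<^sup>2 / (2 * Im z * Im w)"
proof -
  have "1 + (cmod (z - w))\<^sup>2 / (2 * Im z * Im w) \<ge> 1"
    using assms by (simp add: hplane_def)
  then show ?thesis unfolding hdist_def by (rule cosh_arcosh_real)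
qed

lemma hdist_nonneg: "z \<in> hplane \<Longrightarrow> w \<in> hplane \<Longrightarrow> hdist z w \<ge> 0"
  unfolding hdist_def
  by (intro arcosh_nonneg_real) (simp add: hplane_def)

lemma hdist_commute: "hdist z w = hdist w z"
  by (simp add: hdist_def norm_minus_commute mult.commute mult.left_commute)

lemma hdist_eq_iff:
  assumes "z \<in> hplane" "w \<in> hplane" "z' \<in> hplane" "w' \<in> hplane"
  shows "hdist z w = hdist z' w' \<longleftrightarrow>
    (cmod (z - w))\<^sup>2 / (Im z * Im w) = (cmod (z' - w'))\<^sup>2 / (Im z' * Im w')"
proof -
  have "hdist z w = hdist z' w' \<longleftrightarrow> cosh (hdist z w) = cosh (hdist z' w')"
    using assms hdist_nonneg by (metis cosh_real_nonneg_le_iff order_antisym order_refl)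
  moreover have "X / (2 * A * B) = X / (A * B) * (1 / 2)" for X A B :: real by simp
  ultimately show ?thesis
    by (simp only: cosh_hdist assms add_left_cancel mult_cancel_right) simp
qed

lemma hdist_self: "z \<in> hplane \<Longrightarrow> hdist z z = 0"
  by (simp add: hdist_def)

lemma hdist_eq_0:
  assumes "z \<in> hplane" "w \<in> hplane" "hdist z w = 0"
  shows "z = w"
proof -
  have "1 + (cmod (z - w))\<^sup>2 / (2 * Im z * Im w) = 1"
    using cosh_hdist[OF assms(1,2)] assms(3) by simp
  then show ?thesis using assms by (auto simp: hplane_def)
qed

lemma moeb_denom:
  assumes "a * d - b * c = 1" "z \<in> hplane"
  shows "of_real c * z + of_real d \<noteq> 0"
proof
  assume *: "of_real c * z + of_real d = 0"
  then have "c * Im z = 0" "c * Re z + d = 0"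
    by (auto simp: complex_eq_iff)
  then have "c = 0" "d = 0" using assms by (auto simp: hplane_def)
  then show False using assms by simp
qed

lemma Im_moeb:
  assumes "a * d - b * c = 1"
  shows "Im (moeb a b c d z) = Im z / (cmod (of_real c * z + of_real d))\<^sup>2"
proof -
  have "Im (moeb a b c d z) = ((a * d - b * c) * Im z) / (cmod (of_real c * z + of_real d))\<^sup>2"
    unfolding moeb_def by (simp add: Im_divide cmod_power2 algebra_simps)
  then show ?thesis using assms by simp
qed

lemma moeb_hplane:
  assumes "a * d - b * c = 1" "z \<in> hplane"
  shows "moeb a b c d z \<in> hplane"
  using assms moeb_denom[OF assms] by (simp add: hplane_def Im_moeb)

lemma moeb_diff:
  assumes "a * d - b * c = 1" "z \<in> hplane" "w \<in> hplane"
  shows "moeb a b c d z - moeb a b c d w =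
    (z - w) / ((of_real c * z + of_real d) * (of_real c * w + of_real d))"
proof -
  have "moeb a b c d z - moeb a b c d w =
    (of_real (a * d - b * c) * (z - w)) / ((of_real c * z + of_real d) * (of_real c * w + of_real d))"
    using moeb_denom[OF assms(1,2)] moeb_denom[OF assms(1,3)]
    unfolding moeb_def by (simp add: divide_simps) (simp add: algebra_simps)
  then show ?thesis using assms(1) by simp
qed

lemma hdist_moeb:
  assumes "a * d - b * c = 1" "z \<in> hplane" "w \<in> hplane"
  shows "hdist (moeb a b c d z) (moeb a b c d w) = hdist z w"
  using moeb_denom[OF assms(1,2)] moeb_denom[OF assms(1,3)] assms
  by (subst hdist_eq_iff)
     (simp_all add: moeb_hplane moeb_diff Im_moeb norm_divide norm_mult power_divide power_mult_distrib)

lemma moeb_moeb: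
  assumes "a' * d' - b' * c' = 1" "z \<in> hplane"
  shows "moeb a b c d (moeb a' b' c' d' z) =
    moeb (a * a' + b * c') (a * b' + b * d') (c * a' + d * c') (c * b' + d * d') z"
proof -
  define y where "y = of_real c' * z + of_real d'"
  have y: "y \<noteq> 0" using moeb_denom[OF assms] by (simp add: y_def)
  have frac: "(p * (x / y) + q) / (r * (x / y) + s) = (p * x + q * y) / (r * x + s * y)" for p q r s x
  proof -
    have "p * (x / y) + q = (p * x + q * y) / y" "r * (x / y) + s = (r * x + s * y) / y"
      using y by (simp_all add: field_simps)
    then show ?thesis using y by simp
  qed
  show ?thesis unfolding moeb_def y_def[symmetric] frac
    by (simp add: y_def algebra_simps)
qed

lemma moeb_scalar: "e \<noteq> 0 \<Longrightarrow> moeb e 0 0 e z = z"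
  by (simp add: moeb_def)

lemma moeb_inv1:
  assumes "a * d - b * c = 1" "z \<in> hplane"
  shows "moeb d (- b) (- c) a (moeb a b c d z) = z"
proof -
  have "moeb d (- b) (- c) a (moeb a b c d z) = moeb (a * d - b * c) 0 0 (a * d - b * c) z"
    using assms by (simp add: moeb_moeb algebra_simps)
  then show ?thesis using assms by (simp add: moeb_scalar)
qed

lemma moeb_inv2:
  assumes "a * d - b * c = 1" "z \<in> hplane"
  shows "moeb a b c d (moeb d (- b) (- c) a z) = z"
  using moeb_inv1[of d a "-b" "-c" z] assms by (simp add: algebra_simps)

lemma moeb_comp_inverse:
  assumes M: "a * d - b * c = 1" and N: "a' * d' - b' * c' = 1"
  obtains p q r s where "p * s - q * r = 1"
    "\<And>z. z \<in> hplane \<Longrightarrow> moeb a b c d (moeb d' (- b') (- c') a' z) = moeb p q r s z"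
proof
  have N': "d' * a' - (- b') * (- c') = 1" using N by (simp add: algebra_simps)
  show "(a * d' - b * c') * (d * a' - c * b') - (b * a' - a * b') * (c * d' - d * c') = 1"
  proof -
    have "(a * d' - b * c') * (d * a' - c * b') - (b * a' - a * b') * (c * d' - d * c')
       = (a * d - b * c) * (a' * d' - b' * c')" by (simp add: algebra_simps)
    then show ?thesis using M N by simp
  qed
  show "moeb a b c d (moeb d' (- b') (- c') a' z) =
      moeb (a * d' - b * c') (b * a' - a * b') (c * d' - d * c') (d * a' - c * b') z"
    if "z \<in> hplane" for z
    using moeb_moeb[OF N' that, of a b c d] by (simp add: algebra_simps)
qed

lemma relative_moeb:
  assumes M: "a * d - b * c = 1" and N: "a' * d' - b' * c' = 1"
  obtains p q r s where "p * s - q * r = 1"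
    "\<And>z. z \<in> hplane \<Longrightarrow> moeb a b c d (moeb p q r s z) = moeb a' b' c' d' z"
proof -
  have M': "d * a - (- b) * (- c) = 1" and N': "d' * a' - (- b') * (- c') = 1"
    using M N by (simp_all add: mult.commute)
  obtain p q r s where *: "p * s - q * r = 1"
    "\<And>z. z \<in> hplane \<Longrightarrow> moeb d (- b) (- c) a (moeb a' (- (- b')) (- (- c')) d' z) = moeb p q r s z"
    using moeb_comp_inverse[OF M' N'] by metis
  have "moeb a b c d (moeb p q r s z) = moeb a' b' c' d' z" if "z \<in> hplane" for z
    using *(2)[OF that] moeb_inv2[OF M moeb_hplane[OF N that]] by simp
  then show ?thesis using that *(1) by blast
qed

lemma vert_hplane [simp]: "vert t \<in> hplane"
  by (simp add: vert_def hplane_def)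

lemma vert_0: "vert 0 = \<i>"
  by (simp add: vert_def complex_eq_iff)

lemma ii_hplane [simp]: "\<i> \<in> hplane"
  by (simp add: hplane_def)

lemma hdist_vert: "hdist (vert s) (vert t) = \<bar>s - t\<bar>"
proof -
  have "cosh (hdist (vert s) (vert t)) = 1 + (exp s - exp t)\<^sup>2 / (2 * exp s * exp t)"
    by (simp add: cosh_hdist) (simp add: vert_def cmod_power2)
  also have "\<dots> = cosh (s - t)"
    by (simp add: cosh_def exp_diff exp_minus field_simps power2_eq_square)
  finally show ?thesis
    by (metis abs_ge_zero arcosh_cosh_real cosh_real_abs hdist_nonneg vert_hplane)
qed

text \<open>The distance to a point of the axis depends on \<open>x\<close> only through \<open>Im x\<close> and \<open>cmod x\<close>.\<close>

lemma cosh_hdist_vert: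
  assumes "x \<in> hplane"
  shows "cosh (hdist x (vert t)) = ((cmod x)\<^sup>2 * exp (- t) + exp t) / (2 * Im x)"
proof -
  have "(cmod (x - vert t))\<^sup>2 = (cmod x)\<^sup>2 - 2 * exp t * Im x + (exp t)\<^sup>2"
    unfolding cmod_power2 by (simp add: vert_def power2_eq_square algebra_simps)
  moreover have "Im (vert t) = exp t" by (simp add: vert_def)
  moreover have "Im x > 0" using assms by (simp add: hplane_def)
  ultimately show ?thesis
    using assms by (simp add: cosh_hdist exp_minus field_simps power2_eq_square)
qed

lemma moeb_transitive:
  assumes "z \<in> hplane"
  obtains a b c d where "a * d - b * c = 1" "moeb a b c d \<i> = z"
proof
  define r where "r = sqrt (Im z)"
  have r: "r > 0" "r * r = Im z" using assms by (auto simp: r_def hplane_def)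
  show "r * (1 / r) - (Re z / r) * 0 = 1" using r by simp
  show "moeb r (Re z / r) 0 (1 / r) \<i> = z"
    using r by (auto simp: moeb_def complex_eq_iff field_simps)
qed

text \<open>In the hyperboloid model with \<open>\<i>\<close> as base point, the time coordinate of a point is the hyperbolic cosine
of its distance to \<open>\<i>\<close> and the space coordinates form a vector of length the hyperbolic sine of it. The
inequality is then Cauchy--Schwarz for the space coordinates.\<close>

lemma hdist_triangle_ii:
  assumes "z \<in> hplane" "w \<in> hplane"
  shows "hdist z w \<le> hdist z \<i> + hdist \<i> w"
proof -
  define A0 A1 A2 where "A0 = ((cmod z)\<^sup>2 + 1) / (2 * Im z)" "A1 = ((cmod z)\<^sup>2 - 1) / (2 * Im z)" "A2 = Re z / Im z"
  define B0 B1 B2 where "B0 = ((cmod w)\<^sup>2 + 1) / (2 * Im w)" "B1 = ((cmod w)\<^sup>2 - 1) / (2 * Im w)" "B2 = Re w / Im w"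
  note defs = A0_A1_A2_def B0_B1_B2_def
  have pos: "Im z > 0" "Im w > 0" using assms by (auto simp: hplane_def)
  have A: "A0 = cosh (hdist z \<i>)" using cosh_hdist_vert[OF assms(1), of 0] by (simp add: vert_0 defs)
  have B: "B0 = cosh (hdist \<i> w)" using cosh_hdist_vert[OF assms(2), of 0] by (simp add: vert_0 defs hdist_commute)
  have eA: "2 * Im z * A0 = (Re z)\<^sup>2 + (Im z)\<^sup>2 + 1" "2 * Im z * A1 = (Re z)\<^sup>2 + (Im z)\<^sup>2 - 1"
      "Im z * A2 = Re z"
    and eB: "2 * Im w * B0 = (Re w)\<^sup>2 + (Im w)\<^sup>2 + 1" "2 * Im w * B1 = (Re w)\<^sup>2 + (Im w)\<^sup>2 - 1"
      "Im w * B2 = Re w"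
    using pos by (simp_all add: defs cmod_power2)
  have sA: "A1\<^sup>2 + A2\<^sup>2 = (sinh (hdist z \<i>))\<^sup>2"
  proof -
    have "(2 * Im z)\<^sup>2 * (A0\<^sup>2 - 1) = (2 * Im z)\<^sup>2 * (A1\<^sup>2 + A2\<^sup>2)"
      using eA by algebra
    then have "A0\<^sup>2 - 1 = A1\<^sup>2 + A2\<^sup>2" using pos by simp
    then show ?thesis using A by (simp add: sinh_square_eq)
  qed
  have sB: "B1\<^sup>2 + B2\<^sup>2 = (sinh (hdist \<i> w))\<^sup>2"
  proof -
    have "(2 * Im w)\<^sup>2 * (B0\<^sup>2 - 1) = (2 * Im w)\<^sup>2 * (B1\<^sup>2 + B2\<^sup>2)"
      using eB by algebra
    then have "B0\<^sup>2 - 1 = B1\<^sup>2 + B2\<^sup>2" using pos by simp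
    then show ?thesis using B by (simp add: sinh_square_eq)
  qed
  have nn: "sinh (hdist z \<i>) \<ge> 0" "sinh (hdist \<i> w) \<ge> 0"
    using hdist_nonneg assms by simp_all
  have "cosh (hdist z w) = A0 * B0 - (A1 * B1 + A2 * B2)"
  proof -
    have "2 * Im z * Im w * cosh (hdist z w) = 2 * Im z * Im w + (Re z - Re w)\<^sup>2 + (Im z - Im w)\<^sup>2"
      unfolding cosh_hdist[OF assms] cmod_power2 using pos by (simp add: field_simps)
    then have "(4 * Im z * Im w) * cosh (hdist z w) = (4 * Im z * Im w) * (A0 * B0 - (A1 * B1 + A2 * B2))"
      using eA eB by algebra
    then show ?thesis using pos by simp
  qed
  also have "\<dots> \<le> A0 * B0 + sinh (hdist z \<i>) * sinh (hdist \<i> w)"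
  proof -
    have "(A1 * B1 + A2 * B2)\<^sup>2 \<le> (A1\<^sup>2 + A2\<^sup>2) * (B1\<^sup>2 + B2\<^sup>2)"
    proof -
      have "(A1\<^sup>2 + A2\<^sup>2) * (B1\<^sup>2 + B2\<^sup>2) - (A1 * B1 + A2 * B2)\<^sup>2 = (A1 * B2 - A2 * B1)\<^sup>2"
        by (simp add: power2_eq_square algebra_simps)
      then show ?thesis by (metis zero_le_power2 diff_ge_0_iff_ge)
    qed
    also have "\<dots> = (sinh (hdist z \<i>) * sinh (hdist \<i> w))\<^sup>2"
      by (simp add: sA sB power_mult_distrib)
    finally have "\<bar>A1 * B1 + A2 * B2\<bar> \<le> sinh (hdist z \<i>) * sinh (hdist \<i> w)"
      using nn by (metis abs_le_square_iff abs_of_nonneg mult_nonneg_nonneg)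
    then show ?thesis by linarith
  qed
  also have "\<dots> = cosh (hdist z \<i> + hdist \<i> w)" by (simp add: A B cosh_add)
  finally show ?thesis
    using cosh_real_nonneg_le_iff[of "hdist z w" "hdist z \<i> + hdist \<i> w"] assms hdist_nonneg by simp
qed

lemma hdist_triangle:
  assumes "z \<in> hplane" "w \<in> hplane" "v \<in> hplane"
  shows "hdist z w \<le> hdist z v + hdist v w"
proof -
  obtain a b c d where M: "a * d - b * c = 1" "moeb a b c d \<i> = v"
    using moeb_transitive[OF assms(3)] .
  have M': "d * a - (- b) * (- c) = 1" using M by (simp add: algebra_simps)
  let ?N = "moeb d (- b) (- c) a"
  have v: "?N v = \<i>" using moeb_inv1[OF M(1) ii_hplane] M by simp
  show ?thesis
    using hdist_triangle_ii[OF moeb_hplane[OF M' assms(1)] moeb_hplane[OF M' assms(2)]]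
      hdist_moeb[OF M'] assms v by metis
qed

lemma open_hplane: "open hplane"
  unfolding hplane_def by (rule open_halfspace_Im_gt)

lemma convex_hplane: "convex hplane"
  unfolding hplane_def by (rule convex_halfspace_Im_gt)

lemma hball_contains_ball:
  assumes "z \<in> hplane" "\<epsilon> > 0"
  obtains r where "r > 0" "ball z r \<subseteq> hplane" "\<And>w. w \<in> ball z r \<Longrightarrow> hdist z w < \<epsilon>"
proof -
  have "continuous_on hplane (\<lambda>w. cosh (hdist z w))"
  proof (subst continuous_on_cong[OF refl cosh_hdist])
    show "continuous_on hplane (\<lambda>w. 1 + (cmod (z - w))\<^sup>2 / (2 * Im z * Im w))"
      using assms(1) by (intro continuous_intros) (auto simp: hplane_def)
  qed (use assms in auto)
  then have "open (hplane \<inter> (\<lambda>w. cosh (hdist z w)) -` {..<cosh \<epsilon>})"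
    by (intro continuous_open_preimage open_hplane open_lessThan)
  also have "hplane \<inter> (\<lambda>w. cosh (hdist z w)) -` {..<cosh \<epsilon>} = {w \<in> hplane. cosh (hdist z w) < cosh \<epsilon>}"
    by auto
  finally have "open {w \<in> hplane. cosh (hdist z w) < cosh \<epsilon>}" .
  moreover have "cosh \<epsilon> > 1" using cosh_real_nonneg_less_iff[of 0 \<epsilon>] assms(2) by simp
  then have "z \<in> {w \<in> hplane. cosh (hdist z w) < cosh \<epsilon>}" using assms by (simp add: hdist_self)
  ultimately obtain r where r: "r > 0" "ball z r \<subseteq> {w \<in> hplane. cosh (hdist z w) < cosh \<epsilon>}"
    using open_contains_ball by metis
  show ?thesis
  proof (rule that[OF r(1)])
    show "ball z r \<subseteq> hplane" using r by auto
    fix w assume "w \<in> ball z r"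
    then have "w \<in> hplane" "cosh (hdist z w) < cosh \<epsilon>" using r by auto
    then show "hdist z w < \<epsilon>"
      using cosh_real_nonneg_less_iff[of "hdist z w" \<epsilon>] assms hdist_nonneg[of z w] by simp
  qed
qed

lemma moeb_holomorphic:
  assumes "a * d - b * c = 1"
  shows "moeb a b c d holomorphic_on hplane"
  unfolding moeb_def using moeb_denom[OF assms] by (intro holomorphic_intros) auto

lemma moeb_continuous:
  assumes "a * d - b * c = 1"
  shows "continuous_on hplane (moeb a b c d)"
  using moeb_holomorphic[OF assms] by (rule holomorphic_on_imp_continuous_on)

lemma vert_continuous: "continuous_on UNIV vert"
  unfolding vert_def by (simp add: Complex_eq) (intro continuous_intros)

section \<open>Isometries and geodesics of the half-plane\<close>

text \<open>The two distances give two linear equations for \<open>Im x\<close> and \<open>(cmod x)\<^sup>2\<close>, so \<open>x\<close> is determined up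
to the reflection in the axis.\<close>

lemma equidistant_two_axis_points:
  assumes "x \<in> hplane" "w \<in> hplane" "s \<noteq> t"
    and "hdist x (vert s) = hdist w (vert s)" "hdist x (vert t) = hdist w (vert t)"
  shows "x = w \<or> x = - cnj w"
proof -
  have pos: "Im x > 0" "Im w > 0" using assms by (auto simp: hplane_def)
  define R y R' y' where "R = (cmod x)\<^sup>2" and "y = Im x" and "R' = (cmod w)\<^sup>2" and "y' = Im w"
  have e: "(R * exp (- r) + exp r) * y' = (R' * exp (- r) + exp r) * y" if "r = s \<or> r = t" for r
  proof -
    have "(R * exp (- r) + exp r) / (2 * y) = (R' * exp (- r) + exp r) / (2 * y')"
      using that assms(4,5) cosh_hdist_vert[OF assms(1), of r] cosh_hdist_vert[OF assms(2), of r]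
      unfolding R_def R'_def y_def y'_def by metis
    then show ?thesis using pos unfolding y_def y'_def
      by (subst (asm) frac_eq_eq) (auto simp: algebra_simps)
  qed
  have e2: "R * y' - R' * y = (exp r)\<^sup>2 * (y - y')" if "r = s \<or> r = t" for r
  proof -
    have "exp r * exp (- r) = 1" by (simp add: exp_minus)
    then show ?thesis using e[OF that] by algebra
  qed
  have "((exp s)\<^sup>2 - (exp t)\<^sup>2) * (y - y') = 0"
    using e2[of s] e2[of t] by (simp add: algebra_simps)
  moreover have "(exp s)\<^sup>2 \<noteq> (exp t)\<^sup>2"
    using assms(3) by (simp add: power2_eq_iff_nonneg)
  ultimately have y: "y = y'" by simp
  then have "R = R'" using e2[of s] pos by (simp add: y'_def)
  then have "(Re x)\<^sup>2 = (Re w)\<^sup>2" using y by (simp add: R_def R'_def y_def y'_def cmod_power2)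
  then show ?thesis using y by (auto simp: power2_eq_iff complex_eq_iff y_def y'_def)
qed

text \<open>Every point is fixed or reflected. Two points off the axis cannot behave differently, since
reflecting only one of them would change their distance.\<close>

lemma isometry_fixing_two_axis_points:
  assumes B: "B \<subseteq> hplane" "\<psi> ` B \<subseteq> hplane" and iso: "\<And>v w. v \<in> B \<Longrightarrow> w \<in> B \<Longrightarrow> hdist (\<psi> v) (\<psi> w) = hdist v w"
    and st: "s \<noteq> t" "vert s \<in> B" "vert t \<in> B" "\<psi> (vert s) = vert s" "\<psi> (vert t) = vert t"
  shows "(\<forall>w\<in>B. \<psi> w = w) \<or> (\<forall>w\<in>B. \<psi> w = - cnj w)"
proof (rule ccontr)
  assume "\<not> ?thesis"
  then obtain v w where vw: "v \<in> B" "\<psi> v \<noteq> v" "w \<in> B" "\<psi> w \<noteq> - cnj w" by auto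
  have alt: "\<psi> u = u \<or> \<psi> u = - cnj u" if "u \<in> B" for u
    using that B st iso[OF that] by (intro equidistant_two_axis_points[of _ _ s t]) (auto, metis+)
  have v: "\<psi> v = - cnj v" "Re v \<noteq> 0" using alt[OF vw(1)] vw by (auto simp: complex_eq_iff)
  have w: "\<psi> w = w" "Re w \<noteq> 0" using alt[OF vw(3)] vw by (auto simp: complex_eq_iff)
  have "hdist (- cnj v) w = hdist v w" using iso[OF vw(1,3)] v w by simp
  moreover have "v \<in> hplane" "w \<in> hplane" "- cnj v \<in> hplane" using vw B by (auto simp: hplane_def)
  ultimately have "(cmod (- cnj v - w))\<^sup>2 = (cmod (v - w))\<^sup>2"
    by (subst (asm) hdist_eq_iff) (auto simp: hplane_def)
  then have "(- Re v - Re w)\<^sup>2 + (Im v - Im w)\<^sup>2 = (Re v - Re w)\<^sup>2 + (Im v - Im w)\<^sup>2"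
    by (simp only: cmod_power2) simp
  then have "Re v * Re w = 0" by (simp add: power2_eq_square algebra_simps)
  then show False using v w by simp
qed

text \<open>The rotation about \<open>\<i>\<close> by the angle \<open>2 * \<theta>\<close> is the action of the matrix with entries \<open>cos \<theta>\<close> and
\<open>sin \<theta>\<close>. The real part of the image of \<open>w\<close> vanishes if \<open>2 * \<theta>\<close> is the argument of the vector
\<open>(((cmod w)\<^sup>2 - 1) / 2, Re w)\<close>, and a half turn about \<open>\<i>\<close> moves the image above \<open>\<i>\<close> if it is below.\<close>

lemma rotate_to_axis:
  assumes "w \<in> hplane" "w \<noteq> \<i>"
  obtains a b c d t where "a * d - b * c = 1" "moeb a b c d \<i> = \<i>" "moeb a b c d w = vert t" "t > 0"
proof -
  define \<theta> where "\<theta> = Arg (Complex (((cmod w)\<^sup>2 - 1) / 2) (Re w)) / 2"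
  define X where "X = Complex (((cmod w)\<^sup>2 - 1) / 2) (Re w)"
  define C S where "C = cos \<theta>" and "S = sin \<theta>"
  have CS: "C\<^sup>2 + S\<^sup>2 = 1" by (simp add: C_def S_def)
  have "X = cmod X * cis (2 * \<theta>)"
    using rcis_cmod_Arg[of X] by (simp add: \<theta>_def X_def rcis_def)
  then have "Re X = cmod X * cos (2 * \<theta>)" "Im X = cmod X * sin (2 * \<theta>)"
    by (metis Re_complex_of_real Im_complex_of_real cis.simps times_complex.simps mult_zero_left diff_zero add.right_neutral)+
  then have "Re X * sin (2 * \<theta>) = Im X * cos (2 * \<theta>)" by simp
  then have eq: "((cmod w)\<^sup>2 - 1) * (C * S) = Re w * (C\<^sup>2 - S\<^sup>2)"
  proof -
    have "((cmod w)\<^sup>2 - 1) / 2 * (2 * S * C) = Re w * (C\<^sup>2 - S\<^sup>2)"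
      using \<open>Re X * sin (2 * \<theta>) = Im X * cos (2 * \<theta>)\<close>
      by (simp only: sin_double cos_double C_def S_def X_def complex.sel)
    moreover have "((cmod w)\<^sup>2 - 1) / 2 * (2 * S * C) = ((cmod w)\<^sup>2 - 1) * (C * S)"
      by simp
    ultimately show ?thesis by simp
  qed
  define u where "u = moeb C S (- S) C w"
  have det: "C * C - S * (- S) = 1" using CS by (simp add: power2_eq_square)
  have u: "u \<in> hplane" unfolding u_def using moeb_hplane[OF det assms(1)] .
  have "Re u = ((- (C * S)) * ((cmod w)\<^sup>2 - 1) + Re w * (C\<^sup>2 - S\<^sup>2)) / (cmod (- S * w + C))\<^sup>2"
    by (simp add: u_def moeb_def Re_divide cmod_power2)
       (simp add: algebra_simps power2_eq_square)
  then have Reu: "Re u = 0" using eq by (simp add: algebra_simps)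
  have mi: "moeb C S (- S) C \<i> = \<i>"
  proof -
    have "of_real C * \<i> + of_real S = \<i> * (of_real (- S) * \<i> + of_real C)"
      by (simp add: algebra_simps)
    then show ?thesis using moeb_denom[OF det ii_hplane] unfolding moeb_def by simp
  qed
  have une: "u \<noteq> \<i>"
  proof
    assume "u = \<i>"
    then have "hdist w \<i> = 0" using hdist_moeb[OF det assms(1) ii_hplane] mi
      by (simp add: u_def hdist_self)
    then show False using hdist_eq_0[OF assms(1) ii_hplane] assms by simp
  qed
  have Imu: "Im u > 0" using u by (simp add: hplane_def)
  have uv: "u = vert (ln (Im u))" using Reu Imu by (simp add: vert_def complex_eq_iff)
  show ?thesis
  proof (cases "Im u > 1")
    case True
    then show ?thesis using that[OF det mi, of "ln (Im u)"] uv u_def by simp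
  next
    case False
    then have lt: "Im u < 1" using une Reu by (cases "Im u = 1") (auto simp: complex_eq_iff)
    have rot: "moeb 0 1 (-1) 0 (moeb C S (- S) C v) = moeb (- S) C (- C) (- S) v" if "v \<in> hplane" for v
      using moeb_moeb[OF det that, of 0 1 "-1" 0] by simp
    have "moeb 0 1 (-1) 0 u = vert (- ln (Im u))"
      using Reu Imu by (subst uv) (auto simp: moeb_def vert_def complex_eq_iff exp_minus field_simps Re_divide Im_divide power2_eq_square)
    then have 1: "moeb (- S) C (- C) (- S) w = vert (- ln (Im u))" using rot[OF assms(1)] by (simp add: u_def)
    have 2: "moeb (- S) C (- C) (- S) \<i> = \<i>"
    proof -
      have "moeb 0 1 (-1) 0 \<i> = \<i>" by (simp add: moeb_def)
      then show ?thesis using rot[OF ii_hplane] mi by simp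
    qed
    show ?thesis
    proof (rule that[OF _ 2 1])
      show "- S * - S - C * - C = 1" using det by (simp add: add.commute)
    qed (use lt Imu in auto)
  qed
qed

text \<open>One isometry moves \<open>z\<close> to \<open>\<i>\<close>, and a rotation about \<open>\<i>\<close> then moves \<open>w\<close> to the axis. Hence
pairs of points at equal distance are equivalent under isometries.\<close>

lemma geodesic_through_two_points:
  assumes "z \<in> hplane" "w \<in> hplane" "z \<noteq> w"
  obtains a b c d where "a * d - b * c = 1" "moeb a b c d (vert 0) = z"
    "moeb a b c d (vert (hdist z w)) = w"
proof -
  obtain a b c d where M: "a * d - b * c = 1" "moeb a b c d \<i> = z"
    using moeb_transitive[OF assms(1)] .
  define w' where "w' = moeb d (- b) (- c) a w"
  have M': "d * a - (- b) * (- c) = 1" using M by (simp add: algebra_simps)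
  have w': "w' \<in> hplane" "moeb a b c d w' = w"
    using moeb_hplane[OF M' assms(2)] moeb_inv2[OF M(1) assms(2)] by (auto simp: w'_def)
  then have "w' \<noteq> \<i>" using M assms by auto
  then obtain a' b' c' d' t where N: "a' * d' - b' * c' = 1" "moeb a' b' c' d' \<i> = \<i>"
    "moeb a' b' c' d' w' = vert t" "t > 0"
    using rotate_to_axis[OF w'(1)] by metis
  have i: "moeb d' (- b') (- c') a' \<i> = \<i>" "moeb d' (- b') (- c') a' (vert t) = w'"
    using moeb_inv1[OF N(1) ii_hplane] moeb_inv1[OF N(1) w'(1)] N by auto
  obtain p q r s where P: "p * s - q * r = 1"
    "\<And>v. v \<in> hplane \<Longrightarrow> moeb a b c d (moeb d' (- b') (- c') a' v) = moeb p q r s v"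
    using moeb_comp_inverse[OF M(1) N(1)] by metis
  have z: "moeb p q r s (vert 0) = z" and w: "moeb p q r s (vert t) = w"
    using P(2)[of "vert 0"] P(2)[of "vert t"] i M w' by (simp_all add: vert_0)
  have "hdist z w = t"
    using hdist_moeb[OF P(1), of "vert 0" "vert t"] z w N hdist_vert[of 0 t] by simp
  then show ?thesis using that[OF P(1) z] w by simp
qed

text \<open>Compose with isometries on both sides so that two points of \<open>B\<close> become fixed points on the axis.\<close>

lemma isometry_moeb_or_reflected:
  assumes B: "B \<subseteq> hplane" "\<phi> ` B \<subseteq> hplane" "z0 \<in> B" "z1 \<in> B" "z0 \<noteq> z1"
    and iso: "\<And>v w. v \<in> B \<Longrightarrow> w \<in> B \<Longrightarrow> hdist (\<phi> v) (\<phi> w) = hdist v w"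
  obtains a b c d where "a * d - b * c = 1" "\<And>w. w \<in> B \<Longrightarrow> \<phi> w = moeb a b c d w"
  | a b c d where "a * d - b * c = 1" "\<And>w. w \<in> B \<Longrightarrow> \<phi> w = moeb a b c d (- cnj w)"
proof -
  have z: "z0 \<in> hplane" "z1 \<in> hplane" "\<phi> z0 \<in> hplane" "\<phi> z1 \<in> hplane" using B by auto
  define \<delta> where "\<delta> = hdist z0 z1"
  have \<delta>: "\<delta> \<noteq> 0" using hdist_eq_0[OF z(1,2)] B by (auto simp: \<delta>_def)
  have ne: "\<phi> z0 \<noteq> \<phi> z1" using iso[of z0 z1] \<delta> B hdist_self[OF z(4)] by (auto simp: \<delta>_def)
  obtain a b c d where M: "a * d - b * c = 1" "moeb a b c d (vert 0) = z0" "moeb a b c d (vert \<delta>) = z1"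
    using geodesic_through_two_points[OF z(1,2) B(5)] \<delta>_def by metis
  obtain a' b' c' d' where N: "a' * d' - b' * c' = 1" "moeb a' b' c' d' (vert 0) = \<phi> z0"
    "moeb a' b' c' d' (vert \<delta>) = \<phi> z1"
    using geodesic_through_two_points[OF z(3,4) ne] \<delta>_def iso B by metis
  have M': "d * a - (- b) * (- c) = 1" and N': "d' * a' - (- b') * (- c') = 1"
    using M N by (simp_all add: algebra_simps)
  let ?M = "moeb a b c d" and ?N = "moeb a' b' c' d'"
  let ?Mi = "moeb d (- b) (- c) a" and ?Ni = "moeb d' (- b') (- c') a'"
  define B' where "B' = {w \<in> hplane. ?M w \<in> B}"
  define \<psi> where "\<psi> = (\<lambda>w. ?Ni (\<phi> (?M w)))"
  have "(\<forall>w\<in>B'. \<psi> w = w) \<or> (\<forall>w\<in>B'. \<psi> w = - cnj w)"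
  proof (rule isometry_fixing_two_axis_points[of _ _ 0 \<delta>])
    show "B' \<subseteq> hplane" by (auto simp: B'_def)
    show "\<psi> ` B' \<subseteq> hplane" using B moeb_hplane[OF N'] by (auto simp: B'_def \<psi>_def)
    show "hdist (\<psi> v) (\<psi> w) = hdist v w" if "v \<in> B'" "w \<in> B'" for v w
      using that B iso hdist_moeb[OF M(1)] hdist_moeb[OF N']
      by (auto simp: B'_def \<psi>_def image_subset_iff)
    show "vert 0 \<in> B'" "vert \<delta> \<in> B'" using M B by (auto simp: B'_def)
    show "\<psi> (vert 0) = vert 0" "\<psi> (vert \<delta>) = vert \<delta>"
      using M N moeb_inv1[OF N(1), of "vert 0"] moeb_inv1[OF N(1), of "vert \<delta>"] by (auto simp: \<psi>_def)
  qed (use \<delta> in auto)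
  moreover have conj: "?Mi w \<in> B'" "\<phi> w = ?N (\<psi> (?Mi w))" if "w \<in> B" for w
  proof -
    have w: "w \<in> hplane" "\<phi> w \<in> hplane" using that B by auto
    show "?Mi w \<in> B'" using moeb_hplane[OF M' w(1)] moeb_inv2[OF M(1) w(1)] that by (simp add: B'_def)
    show "\<phi> w = ?N (\<psi> (?Mi w))"
      using moeb_inv2[OF M(1) w(1)] moeb_inv2[OF N(1) w(2)] by (simp add: \<psi>_def)
  qed
  ultimately consider "\<forall>w\<in>B. \<phi> w = ?N (?Mi w)" | "\<forall>w\<in>B. \<phi> w = ?N (- cnj (?Mi w))" by metis
  then show ?thesis
  proof cases
    case 1
    obtain p q r s where "p * s - q * r = 1" "\<And>z. z \<in> hplane \<Longrightarrow> ?N (?Mi z) = moeb p q r s z"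
      using moeb_comp_inverse[OF N(1) M(1)] by metis
    then show ?thesis using that(1)[of p s q r] 1 B by (simp add: subset_iff)
  next
    case 2
    have refl: "- cnj (?Mi w) = moeb d b c a (- cnj w)" for w
    proof -
      have "- cnj (?Mi w) = (- (of_real d * cnj w - of_real b)) / (of_real a - of_real c * cnj w)"
        by (simp add: moeb_def minus_divide_left)
      also have "\<dots> = moeb d b c a (- cnj w)"
        by (simp add: moeb_def)
      finally show ?thesis .
    qed
    have "b * c - a * d = -1" using M by simp
    have "d * a - b * c = 1" using M(1) by (simp add: mult.commute)
    then have "a * d - (- b) * (- c) = 1" by (simp add: mult.commute)
    then obtain p q r s where "p * s - q * r = 1"
      "\<And>z. z \<in> hplane \<Longrightarrow> ?N (moeb d (- (- b)) (- (- c)) a z) = moeb p q r s z"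
      using moeb_comp_inverse[OF N(1)] by metis
    then have "p * s - q * r = 1" "\<And>z. z \<in> hplane \<Longrightarrow> ?N (moeb d b c a z) = moeb p q r s z"
      by simp_all
    moreover have "- cnj w \<in> hplane" if "w \<in> B" for w using that B by (auto simp: hplane_def)
    ultimately show ?thesis using that(2)[of p s q r] 2 B refl by auto
  qed
qed

lemma unit_speed_eq_vert:
  assumes "x \<in> hplane" "s \<noteq> t" "hdist x (vert s) = \<bar>u - s\<bar>" "hdist x (vert t) = \<bar>u - t\<bar>"
  shows "x = vert u"
proof -
  have "x = vert u \<or> x = - cnj (vert u)"
    by (rule equidistant_two_axis_points[of _ _ s t]) (use assms hdist_vert in auto)
  then show ?thesis by (auto simp: vert_def complex_eq_iff)
qed

text \<open>A point of a geodesic is determined by its distances to two other points of it, because the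
axis is fixed by the reflection in the axis.\<close>

lemma unit_speed_segment_unique:
  assumes M: "a * d - b * c = 1" and I: "s \<in> I" "t \<in> I" "s \<noteq> t"
    and g: "g ` I \<subseteq> hplane" "\<And>u v. u \<in> I \<Longrightarrow> v \<in> I \<Longrightarrow> hdist (g u) (g v) = \<bar>u - v\<bar>"
    and eq: "g s = moeb a b c d (vert s)" "g t = moeb a b c d (vert t)" and u: "u \<in> I"
  shows "g u = moeb a b c d (vert u)"
proof -
  have gu: "g u \<in> hplane" using g u by auto
  have M': "d * a - (- b) * (- c) = 1" using M by (simp add: algebra_simps)
  define x where "x = moeb d (- b) (- c) a (g u)"
  have x: "x \<in> hplane" "moeb a b c d x = g u"
    using moeb_hplane[OF M' gu] moeb_inv2[OF M gu] by (auto simp: x_def)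
  have "hdist x (vert v) = \<bar>u - v\<bar>" if "v = s \<or> v = t" for v
  proof -
    have "hdist x (vert v) = hdist (g u) (g v)"
      using hdist_moeb[OF M x(1), of "vert v"] that eq x by auto
    also have "\<dots> = \<bar>u - v\<bar>" using g(2)[OF u] that I by blast
    finally show ?thesis .
  qed
  then have "x = vert u" using unit_speed_eq_vert[OF x(1) I(3)] by blast
  then show ?thesis using x by simp
qed

lemma hdist_geodesic:
  assumes "a * d - b * c = 1"
  shows "hdist (moeb a b c d (vert s)) (moeb a b c d (vert t)) = \<bar>s - t\<bar>"
  by (simp add: hdist_moeb[OF assms] hdist_vert)

text \<open>The geodesic through two points of the segment has to be reparametrized by the
dilation \<open>e\<^sup>2 = exp (- t)\<close>, which shifts the time parameter by \<open>t\<close>.\<close>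

lemma local_geodesic_segment:
  assumes "\<epsilon> > 0" and g: "\<And>u. \<bar>u - t\<bar> < \<epsilon> \<Longrightarrow> g u \<in> hplane"
    "\<And>u v. \<bar>u - t\<bar> < \<epsilon> \<Longrightarrow> \<bar>v - t\<bar> < \<epsilon> \<Longrightarrow> hdist (g u) (g v) = \<bar>u - v\<bar>"
  obtains a b c d where "a * d - b * c = 1" "\<And>u. \<bar>u - t\<bar> < \<epsilon> \<Longrightarrow> g u = moeb a b c d (vert u)"
proof -
  define \<delta> where "\<delta> = \<epsilon> / 2"
  have \<delta>: "\<bar>t + \<delta> - t\<bar> < \<epsilon>" "\<bar>t - t\<bar> < \<epsilon>" "\<delta> > 0" using assms(1) by (auto simp: \<delta>_def)
  have gg: "hdist (g t) (g (t + \<delta>)) = \<delta>" using g(2)[OF \<delta>(2,1)] \<delta> by simp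
  have ne: "g t \<noteq> g (t + \<delta>)" using gg \<delta> hdist_self g(1)[OF \<delta>(1)] by force
  obtain a b c d where M: "a * d - b * c = 1" "moeb a b c d (vert 0) = g t"
    "moeb a b c d (vert \<delta>) = g (t + \<delta>)"
    using geodesic_through_two_points[OF g(1)[OF \<delta>(2)] g(1)[OF \<delta>(1)] ne] gg by metis
  define e where "e = exp (- t / 2)"
  have e: "e * (1 / e) = 1" "e > 0" "exp u = e * e * exp (t + u)" for u
    by (simp_all add: e_def flip: exp_add)
  have det: "(a * e) * (d / e) - (b / e) * (c * e) = 1" using M e by (simp add: field_simps)
  have sh: "moeb (a * e) (b / e) (c * e) (d / e) (vert (t + u)) = moeb a b c d (vert u)" for u
  proof -
    have "e * (1 / e) - 0 * 0 = 1" using e by simp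
    from moeb_moeb[OF this, of "vert (t + u)" a b c d]
    have "moeb (a * e) (b / e) (c * e) (d / e) (vert (t + u)) = moeb a b c d (moeb e 0 0 (1 / e) (vert (t + u)))"
      by simp
    also have "moeb e 0 0 (1 / e) (vert (t + u)) = vert u"
      using e(3)[of u] e(2) by (simp add: moeb_def vert_def complex_eq_iff)
    finally show ?thesis .
  qed
  show ?thesis
  proof (rule that[OF det])
    fix u assume u: "\<bar>u - t\<bar> < \<epsilon>"
    show "g u = moeb (a * e) (b / e) (c * e) (d / e) (vert u)"
      by (rule unit_speed_segment_unique[OF det, of t "{u. \<bar>u - t\<bar> < \<epsilon>}" "t + \<delta>"])
         (use \<delta> g u M sh[of 0] sh[of \<delta>] in auto)
  qed
qed

text \<open>The set of times near which \<open>g\<close> agrees with the line that it follows at time \<open>0\<close> is open and closed,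
since two lines that share a segment are equal.\<close>

lemma local_geodesic_is_geodesic:
  fixes g :: "real \<Rightarrow> complex"
  assumes g: "range g \<subseteq> hplane"
    and loc: "\<And>t. \<exists>\<epsilon>>0. \<forall>u v. \<bar>u - t\<bar> < \<epsilon> \<and> \<bar>v - t\<bar> < \<epsilon> \<longrightarrow> hdist (g u) (g v) = \<bar>u - v\<bar>"
  obtains a b c d where "a * d - b * c = 1" "\<And>t. g t = moeb a b c d (vert t)"
proof -
  obtain \<epsilon> where \<epsilon>: "\<And>t. \<epsilon> t > 0"
    "\<And>t u v. \<bar>u - t\<bar> < \<epsilon> t \<Longrightarrow> \<bar>v - t\<bar> < \<epsilon> t \<Longrightarrow> hdist (g u) (g v) = \<bar>u - v\<bar>"
    using loc by metis
  have gh: "g u \<in> hplane" for u using g by auto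
  obtain a b c d where M: "a * d - b * c = 1" "\<And>u. \<bar>u - 0\<bar> < \<epsilon> 0 \<Longrightarrow> g u = moeb a b c d (vert u)"
    using local_geodesic_segment[of "\<epsilon> 0" 0 g] \<epsilon> gh by metis
  define E where "E = {t. \<exists>r>0. \<forall>u. \<bar>u - t\<bar> < r \<longrightarrow> g u = moeb a b c d (vert u)}"
  have spread: "t \<in> E" if s: "s \<in> E" "\<bar>s - t\<bar> < \<epsilon> t" for s t
  proof -
    obtain r where r: "r > 0" "\<And>u. \<bar>u - s\<bar> < r \<Longrightarrow> g u = moeb a b c d (vert u)"
      using s by (auto simp: E_def)
    \<comment> \<open>A second time near both \<open>s\<close> and \<open>t\<close>, since agreement at two times is needed.\<close>
    define s' where "s' = s + min (r / 2) ((\<epsilon> t - \<bar>s - t\<bar>) / 2)"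
    have s': "s' \<noteq> s" "\<bar>s' - s\<bar> < r" "\<bar>s' - t\<bar> < \<epsilon> t" using r(1) s(2)
      by (auto simp: s'_def min_def abs_if field_simps split: if_splits)
    have "g u = moeb a b c d (vert u)" if "\<bar>u - t\<bar> < \<epsilon> t" for u
      by (rule unit_speed_segment_unique[OF M(1), of s "{u. \<bar>u - t\<bar> < \<epsilon> t}" s'])
         (use s s' r that gh \<epsilon>(2)[of _ t] in auto)
    then show ?thesis using \<epsilon>(1) by (auto simp: E_def)
  qed
  have "open E"
    unfolding open_dist
  proof
    fix t assume "t \<in> E"
    then obtain r where r: "r > 0" "\<And>u. \<bar>u - t\<bar> < r \<Longrightarrow> g u = moeb a b c d (vert u)"
      by (auto simp: E_def)
    have "s \<in> E" if "\<bar>s - t\<bar> < r" for s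
      unfolding E_def using that by (auto intro!: exI[of _ "r - \<bar>s - t\<bar>"] r)
    then show "\<exists>e>0. \<forall>y. dist y t < e \<longrightarrow> y \<in> E" using r(1) by (auto simp: dist_real_def)
  qed
  moreover have "open (- E)"
    unfolding open_dist
  proof
    fix t assume "t \<in> - E"
    then have "\<forall>s. dist s t < \<epsilon> t \<longrightarrow> s \<in> - E" using spread by (auto simp: dist_real_def)
    then show "\<exists>e>0. \<forall>s. dist s t < e \<longrightarrow> s \<in> - E" using \<epsilon>(1) by blast
  qed
  ultimately have "E = {} \<or> E = UNIV" using clopen closed_def by blast
  moreover have "0 \<in> E" using M(2) \<epsilon>(1)[of 0] by (auto simp: E_def)
  ultimately have "E = UNIV" by auto
  then have "g t = moeb a b c d (vert t)" for t
  proof -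
    have "t \<in> E" using \<open>E = UNIV\<close> by simp
    then show ?thesis unfolding E_def by force
  qed
  then show ?thesis using that M(1) by blast
qed

section \<open>Lifting curves to the universal cover\<close>

text \<open>Lifts through evenly covered neighbourhoods are glued along a subdivision of the interval. The
base is an arbitrary topological space, and the prescribed point may lie anywhere in the interval,
so that the same statement also extends lifts to the left.\<close>

lemma covering_space_lift_interval:
  fixes p :: "'b::topological_space \<Rightarrow> 'a::topological_space" and f :: "real \<Rightarrow> 'a"
  assumes cov: "covering_space C p S" and ab: "a \<le> b"
    and f: "continuous_on {a..b} f" "f ` {a..b} \<subseteq> S"
    and c: "c \<in> {a..b}" "z \<in> C" "p z = f c"
  obtains h where "continuous_on {a..b} h" "h ` {a..b} \<subseteq> C" "h c = z"
    "\<And>t. t \<in> {a..b} \<Longrightarrow> p (h t) = f t"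
proof -
  define P where "P x y \<longleftrightarrow> (a \<le> x \<and> y \<le> b \<longrightarrow> (\<forall>c\<in>{x..y}. \<forall>z\<in>C. p z = f c \<longrightarrow>
     (\<exists>h. continuous_on {x..y} h \<and> h ` {x..y} \<subseteq> C \<and> h c = z \<and> (\<forall>t\<in>{x..y}. p (h t) = f t))))"
    for x y
  have "P a b"
    using ab
  proof (induction a b rule: Bolzano)
    case (trans x y w)
    show ?case
      unfolding P_def
    proof (intro impI ballI)
      fix c z assume bd: "a \<le> x \<and> w \<le> b" and c: "c \<in> {x..w}" and z: "z \<in> C" "p z = f c"
      have P1: "\<exists>h. continuous_on {x..y} h \<and> h ` {x..y} \<subseteq> C \<and> h c' = z' \<and> (\<forall>t\<in>{x..y}. p (h t) = f t)"
        if "c' \<in> {x..y}" "z' \<in> C" "p z' = f c'" for c' z'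
        using trans bd that unfolding P_def by auto
      have P2: "\<exists>h. continuous_on {y..w} h \<and> h ` {y..w} \<subseteq> C \<and> h c' = z' \<and> (\<forall>t\<in>{y..w}. p (h t) = f t)"
        if "c' \<in> {y..w}" "z' \<in> C" "p z' = f c'" for c' z'
        using trans bd that unfolding P_def by auto
      obtain h1 h2 where h: "continuous_on {x..y} h1" "h1 ` {x..y} \<subseteq> C" "\<forall>t\<in>{x..y}. p (h1 t) = f t"
        "continuous_on {y..w} h2" "h2 ` {y..w} \<subseteq> C" "\<forall>t\<in>{y..w}. p (h2 t) = f t" "h1 y = h2 y"
        "(if c \<le> y then h1 c else h2 c) = z"
      proof (cases "c \<le> y")
        case True
        then obtain h1 where h1: "continuous_on {x..y} h1" "h1 ` {x..y} \<subseteq> C" "h1 c = z" "\<forall>t\<in>{x..y}. p (h1 t) = f t"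
          using P1[of c z] c z by auto
        moreover have "y \<in> {x..y}" "y \<in> {y..w}" using trans by auto
        moreover then obtain h2 where "continuous_on {y..w} h2" "h2 ` {y..w} \<subseteq> C" "h2 y = h1 y" "\<forall>t\<in>{y..w}. p (h2 t) = f t"
          using P2[of y "h1 y"] h1 by (metis image_subset_iff)
        ultimately show ?thesis using that True by auto
      next
        case False
        then obtain h2 where h2: "continuous_on {y..w} h2" "h2 ` {y..w} \<subseteq> C" "h2 c = z" "\<forall>t\<in>{y..w}. p (h2 t) = f t"
          using P2[of c z] c z by auto
        moreover have "y \<in> {x..y}" "y \<in> {y..w}" using trans by auto
        moreover then obtain h1 where "continuous_on {x..y} h1" "h1 ` {x..y} \<subseteq> C" "h1 y = h2 y" "\<forall>t\<in>{x..y}. p (h1 t) = f t"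
          using P1[of y "h2 y"] h2 by (metis image_subset_iff)
        ultimately show ?thesis using that False by auto
      qed
      define h where "h t = (if t \<le> y then h1 t else h2 t)" for t
      have "continuous_on ({x..y} \<union> {y..w}) h"
        unfolding h_def using h by (intro continuous_on_cases) auto
      moreover have "{x..y} \<union> {y..w} = {x..w}" using trans by auto
      ultimately have "continuous_on {x..w} h" by simp
      moreover have "h ` {x..w} \<subseteq> C" "\<forall>t\<in>{x..w}. p (h t) = f t" "h c = z"
        using h by (auto simp: h_def)
      ultimately show "\<exists>h. continuous_on {x..w} h \<and> h ` {x..w} \<subseteq> C \<and> h c = z \<and> (\<forall>t\<in>{x..w}. p (h t) = f t)"
        by blast
    qed
  next
    case (local x0)
    then have "f x0 \<in> S" using f by auto
    then obtain T v where T: "f x0 \<in> T" "openin (top_of_set S) T" "\<Union>v = C \<inter> p -` T"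
      "\<And>u. u \<in> v \<Longrightarrow> \<exists>q. homeomorphism u T p q"
      using cov unfolding covering_space_def by metis
    have "openin (top_of_set {a..b}) ({a..b} \<inter> f -` T)"
      using continuous_openin_preimage[OF f(1) _ T(2)] f(2) by auto
    then have "\<exists>e>0. \<forall>t\<in>{a..b}. dist t x0 < e \<longrightarrow> f t \<in> T"
      using local T(1) unfolding openin_euclidean_subtopology_iff by auto
    then obtain e where e: "e > 0" "\<And>t. t \<in> {a..b} \<Longrightarrow> dist t x0 < e \<Longrightarrow> f t \<in> T"
      by blast
    have "P x y" if xy: "x \<le> x0" "x0 \<le> y" "y - x < e" for x y
      unfolding P_def
    proof (intro impI ballI)
      fix c z assume bd: "a \<le> x \<and> y \<le> b" and c: "c \<in> {x..y}" and z: "z \<in> C" "p z = f c"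
      have fT: "f t \<in> T" if "t \<in> {x..y}" for t
        using e(2)[of t] xy bd that by (auto simp: dist_real_def)
      then have "z \<in> \<Union>v" using z c T(3) by auto
      then obtain u where u: "u \<in> v" "z \<in> u" by auto
      then obtain q where q: "homeomorphism u T p q" using T(4) by blast
      show "\<exists>h. continuous_on {x..y} h \<and> h ` {x..y} \<subseteq> C \<and> h c = z \<and> (\<forall>t\<in>{x..y}. p (h t) = f t)"
      proof (intro exI[of _ "q \<circ> f"] conjI ballI)
        have "continuous_on (f ` {x..y}) q"
          using q fT by (meson continuous_on_subset homeomorphism_def image_subsetI)
        moreover have "continuous_on {x..y} f" using f(1) bd by (auto intro: continuous_on_subset)
        ultimately show "continuous_on {x..y} (q \<circ> f)" by (rule continuous_on_compose[rotated])
        show "(q \<circ> f) ` {x..y} \<subseteq> C"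
          using q fT u T(3) unfolding homeomorphism_def by fastforce
        show "(q \<circ> f) c = z" using q u z by (metis comp_apply homeomorphism_def)
        show "p ((q \<circ> f) t) = f t" if "t \<in> {x..y}" for t
          using q fT[OF that] by (simp add: homeomorphism_def)
      qed
    qed
    then show ?case using e(1) by blast
  qed
  then have "\<exists>h. continuous_on {a..b} h \<and> h ` {a..b} \<subseteq> C \<and> h c = z \<and> (\<forall>t\<in>{a..b}. p (h t) = f t)"
    using c unfolding P_def by blast
  then show ?thesis using that by blast
qed

text \<open>Lifts on the intervals of radius \<open>n\<close> about \<open>c\<close> extend each other by uniqueness of lifts.\<close>

lemma covering_space_lift_real_line:
  fixes p :: "'b::real_normed_vector \<Rightarrow> 'a::topological_space" and f :: "real \<Rightarrow> 'a"
  assumes cov: "covering_space C p S" and f: "continuous_on UNIV f" "range f \<subseteq> S"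
    and c: "z \<in> C" "p z = f c"
  obtains h where "continuous_on UNIV h" "range h \<subseteq> C" "h c = z" "\<And>t. p (h t) = f t"
proof -
  define I where "I n = {c - real n..c + real n}" for n
  have "\<exists>h. continuous_on (I n) h \<and> h ` I n \<subseteq> C \<and> h c = z \<and> (\<forall>t\<in>I n. p (h t) = f t)" for n
  proof -
    have "continuous_on {c - real n..c + real n} f" using f(1) continuous_on_subset by blast
    moreover have "f ` {c - real n..c + real n} \<subseteq> S" "c - real n \<le> c + real n" "c \<in> {c - real n..c + real n}"
      using f(2) by auto
    ultimately show ?thesis unfolding I_def
      using covering_space_lift_interval[OF cov, where a = "c - real n" and b = "c + real n"
          and f = f and c = c and z = z] c by metis
  qed
  then obtain H where H: "\<And>n. continuous_on (I n) (H n)" "\<And>n. H n ` I n \<subseteq> C" "\<And>n. H n c = z"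
    "\<And>n t. t \<in> I n \<Longrightarrow> p (H n t) = f t" by metis
  have agree: "H m t = H n t" if "m \<le> n" "t \<in> I m" for m n t
  proof (rule covering_space_lift_unique[OF cov, of "H m" c "H n" "I m" f])
    have sub: "I m \<subseteq> I n" using that by (auto simp: I_def)
    show "continuous_on (I m) f" using f(1) continuous_on_subset by blast
    show "continuous_on (I m) (H n)" using H(1) sub continuous_on_subset by blast
    show "H n \<in> I m \<rightarrow> C" using H(2) sub by blast
    show "f x = p (H n x)" if "x \<in> I m" for x using H(4) sub that by auto
    show "f x = p (H m x)" if "x \<in> I m" for x using H(4) that by auto
  qed (use H f that in \<open>auto simp: I_def\<close>)
  define h where "h t = H (nat \<lceil>\<bar>t - c\<bar>\<rceil>) t" for t
  have mem: "t \<in> I (nat \<lceil>\<bar>t - c\<bar>\<rceil>)" for t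
  proof -
    have "\<bar>t - c\<bar> \<le> real (nat \<lceil>\<bar>t - c\<bar>\<rceil>)" by (rule real_nat_ceiling_ge)
    then show ?thesis unfolding I_def atLeastAtMost_iff by linarith
  qed
  have h: "h t = H n t" if "t \<in> I n" for n t
  proof -
    have "\<bar>t - c\<bar> \<le> real n" using that by (auto simp: I_def)
    then have "nat \<lceil>\<bar>t - c\<bar>\<rceil> \<le> n" by (simp add: ceiling_le_iff nat_le_iff)
    then show ?thesis unfolding h_def using agree mem by blast
  qed
  have "isCont h t" for t
  proof -
    define n where "n = Suc (nat \<lceil>\<bar>t - c\<bar>\<rceil>)"
    have t: "t \<in> interior (I n)"
      using real_nat_ceiling_ge[of "\<bar>t - c\<bar>"]
      unfolding n_def I_def interior_atLeastAtMost_real greaterThanLessThan_iff of_nat_Suc by linarith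
    have "continuous_on (I n) h" using H(1)[of n] h by (simp cong: continuous_on_cong)
    then show ?thesis using t by (rule continuous_on_interior)
  qed
  then have "continuous_on UNIV h" by (simp add: continuous_on_eq_continuous_at)
  moreover have "h t \<in> C" for t
    unfolding h_def using H(2) mem by blast
  moreover have "p (h t) = f t" for t unfolding h_def using H(4) mem by blast
  moreover have "h c = z" unfolding h_def using H(3) by blast
  ultimately show ?thesis using that by blast
qed

text \<open>The sums in the definition of \<^const>\<open>curve_length\<close>, by recursion over the list of times.\<close>

fun polygon_length :: "(real \<Rightarrow> 'a::metric_space) \<Rightarrow> real list \<Rightarrow> real" where
  "polygon_length g (x # y # xs) = dist (g x) (g y) + polygon_length g (y # xs)"
| "polygon_length g _ = 0"

lemma polygon_length_eq_sum:
  "polygon_length g t = (\<Sum>i<length t - 1. dist (g (t ! i)) (g (t ! Suc i)))"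
proof (induction t rule: induct_list012)
  case (3 x y zs)
  have "(\<Sum>i<Suc (length zs). dist (g ((x # y # zs) ! i)) (g ((x # y # zs) ! Suc i)))
      = dist (g x) (g y) + (\<Sum>i<length zs. dist (g ((y # zs) ! i)) (g ((y # zs) ! Suc i)))"
    by (subst sum.lessThan_Suc_shift) simp
  then show ?case using 3(2) by simp
qed simp_all

lemma polygon_length_append:
  "polygon_length g (xs @ [y] @ ys) = polygon_length g (xs @ [y]) + polygon_length g (y # ys)"
proof (induction xs rule: induct_list012)
  case (3 x x' zs)
  show ?case using 3(2) by simp
qed simp_all

lemma polygon_length_le_curve_length:
  assumes "sorted t" "set t \<subseteq> {0..1}"
  shows "ereal (polygon_length g t) \<le> curve_length g"
  unfolding curve_length_def polygon_length_eq_sum by (rule SUP_upper) (use assms in auto)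

lemma universal_cover_simps:
  assumes "universal_cover S \<pi>"
  shows "covering_space hplane \<pi> S" "continuous_on hplane \<pi>" "\<pi> ` hplane = S"
proof -
  show cov: "covering_space hplane \<pi> S" using assms by (simp add: universal_cover_def)
  show "continuous_on hplane \<pi>" "\<pi> ` hplane = S"
    using covering_space_imp_continuous[OF cov] covering_space_imp_surjective[OF cov] by auto
qed

lemma universal_cover_local_isometry:
  assumes "universal_cover S \<pi>" "z \<in> hplane"
  obtains r where "r > 0" "ball z r \<subseteq> hplane"
    "\<And>v w. v \<in> ball z r \<Longrightarrow> w \<in> ball z r \<Longrightarrow> dist (\<pi> v) (\<pi> w) = hdist v w"
proof -
  obtain \<epsilon> where \<epsilon>: "\<epsilon> > 0"
    "\<And>v w. v \<in> hplane \<Longrightarrow> w \<in> hplane \<Longrightarrow> hdist z v < \<epsilon> \<Longrightarrow> hdist z w < \<epsilon> \<Longrightarrow> dist (\<pi> v) (\<pi> w) = hdist v w"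
    using assms unfolding universal_cover_def by blast
  obtain r where "r > 0" "ball z r \<subseteq> hplane" "\<And>w. w \<in> ball z r \<Longrightarrow> hdist z w < \<epsilon>"
    using hball_contains_ball[OF assms(2) \<epsilon>(1)] by blast
  then show ?thesis using that \<epsilon> by (meson subsetD)
qed

text \<open>On short intervals the cover is isometric, so a fine inscribed polygon of the curve has the same
length as the corresponding polygon of its lift, which the triangle inequality bounds from below.\<close>

lemma hdist_le_curve_length:
  assumes uc: "universal_cover S \<pi>" and h: "continuous_on {0..1} h" "h ` {0..1} \<subseteq> hplane"
    and lift: "\<And>t. t \<in> {0..1} \<Longrightarrow> \<pi> (h t) = g t" and st: "0 \<le> s" "s \<le> t" "t \<le> 1"
  shows "ereal (hdist (h s) (h t)) \<le> curve_length g"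
proof -
  define P where "P x y \<longleftrightarrow> (0 \<le> x \<and> x \<le> y \<and> y \<le> 1 \<longrightarrow>
    (\<exists>ts. sorted (x # ts @ [y]) \<and> hdist (h x) (h y) \<le> polygon_length g (x # ts @ [y])))" for x y
  have "P s t"
    using st(2)
  proof (induction s t rule: Bolzano)
    case (trans x y z)
    show ?case
      unfolding P_def
    proof
      assume b: "0 \<le> x \<and> x \<le> z \<and> z \<le> 1"
      obtain ts where ts: "sorted (x # ts @ [y])" "hdist (h x) (h y) \<le> polygon_length g (x # ts @ [y])"
        using trans b unfolding P_def by auto
      obtain us where us: "sorted (y # us @ [z])" "hdist (h y) (h z) \<le> polygon_length g (y # us @ [z])"
        using trans b unfolding P_def by auto
      have "h x \<in> hplane" "h y \<in> hplane" "h z \<in> hplane" using b trans h(2) by auto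
      then have "hdist (h x) (h z) \<le> hdist (h x) (h y) + hdist (h y) (h z)"
        by (intro hdist_triangle)
      also have "\<dots> \<le> polygon_length g (x # (ts @ y # us) @ [z])"
        using ts us polygon_length_append[of g "x # ts" y "us @ [z]"] by simp
      finally have "hdist (h x) (h z) \<le> polygon_length g (x # (ts @ y # us) @ [z])" .
      moreover have "sorted (x # (ts @ y # us) @ [z])"
        using ts(1) us(1) by (auto simp: sorted_append) (meson order_trans)+
      ultimately show "\<exists>ts. sorted (x # ts @ [z]) \<and> hdist (h x) (h z) \<le> polygon_length g (x # ts @ [z])"
        by blast
    qed
  next
    case (local x)
    then have x: "x \<in> {0..1}" using st by auto
    then have "h x \<in> hplane" using h by auto
    then obtain r where r: "r > 0"
      "\<And>v w. v \<in> ball (h x) r \<Longrightarrow> w \<in> ball (h x) r \<Longrightarrow> dist (\<pi> v) (\<pi> w) = hdist v w"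
      using universal_cover_local_isometry[OF uc] by metis
    obtain d where d: "d > 0" "\<And>u. u \<in> {0..1} \<Longrightarrow> dist u x < d \<Longrightarrow> dist (h u) (h x) < r"
      using h(1) x r(1) unfolding continuous_on_iff by metis
    have "P u v" if "u \<le> x" "x \<le> v" "v - u < d" for u v
      unfolding P_def
    proof
      assume "0 \<le> u \<and> u \<le> v \<and> v \<le> 1"
      moreover then have "h u \<in> ball (h x) r" "h v \<in> ball (h x) r"
        using d(2)[of u] d(2)[of v] that by (auto simp: dist_commute dist_real_def)
      ultimately have "hdist (h u) (h v) = dist (g u) (g v)"
        using r(2) lift by (metis atLeastAtMost_iff order_trans)
      then show "\<exists>ts. sorted (u # ts @ [v]) \<and> hdist (h u) (h v) \<le> polygon_length g (u # ts @ [v])"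
        using \<open>0 \<le> u \<and> u \<le> v \<and> v \<le> 1\<close> by (intro exI[of _ "[]"]) auto
    qed
    then show ?case using d(1) by blast
  qed
  then obtain ts where ts: "sorted (s # ts @ [t])" "hdist (h s) (h t) \<le> polygon_length g (s # ts @ [t])"
    using st unfolding P_def by auto
  have "set (s # ts @ [t]) \<subseteq> {s..t}" using ts(1) st by (auto simp: sorted_append)
  then have "ereal (polygon_length g (s # ts @ [t])) \<le> curve_length g"
    using ts(1) st by (intro polygon_length_le_curve_length) (auto dest!: subsetD)
  then show ?thesis using ts(2) by (meson ereal_less_eq(3) order_trans)
qed

lemma closed_geodesic_continuous:
  assumes "closed_geodesic S \<omega> l"
  shows "continuous_on UNIV \<omega>"
  unfolding continuous_on_iff
proof (intro ballI allI impI)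
  fix t e :: real assume "e > 0"
  obtain \<epsilon> where \<epsilon>: "\<epsilon> > 0" "\<And>s u. \<bar>s - t\<bar> < \<epsilon> \<Longrightarrow> \<bar>u - t\<bar> < \<epsilon> \<Longrightarrow> dist (\<omega> s) (\<omega> u) = \<bar>s - u\<bar>"
    using assms unfolding closed_geodesic_def by metis
  show "\<exists>d>0. \<forall>s\<in>UNIV. dist s t < d \<longrightarrow> dist (\<omega> s) (\<omega> t) < e"
    using \<epsilon> \<open>e > 0\<close> by (intro exI[of _ "min \<epsilon> e"]) (auto simp: dist_real_def)
qed

text \<open>The cover is locally isometric, so a lift of a local geodesic is a local geodesic of the half-plane.\<close>

lemma lift_of_closed_geodesic:
  assumes uc: "universal_cover S \<pi>" and \<omega>: "closed_geodesic S \<omega> l"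
    and h: "continuous_on UNIV h" "range h \<subseteq> hplane" "\<And>t. \<pi> (h t) = \<omega> t"
  obtains a b c d where "a * d - b * c = 1" "\<And>t. h t = moeb a b c d (vert t)"
proof (rule local_geodesic_is_geodesic[OF h(2)])
  fix t
  obtain \<epsilon> where \<epsilon>: "\<epsilon> > 0" "\<And>s u. \<bar>s - t\<bar> < \<epsilon> \<Longrightarrow> \<bar>u - t\<bar> < \<epsilon> \<Longrightarrow> dist (\<omega> s) (\<omega> u) = \<bar>s - u\<bar>"
    using \<omega> unfolding closed_geodesic_def by metis
  obtain r where r: "r > 0"
    "\<And>v w. v \<in> ball (h t) r \<Longrightarrow> w \<in> ball (h t) r \<Longrightarrow> dist (\<pi> v) (\<pi> w) = hdist v w"
    using universal_cover_local_isometry[OF uc] h(2) by (metis range_subsetD)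
  obtain d where d: "d > 0" "\<And>u. dist u t < d \<Longrightarrow> dist (h u) (h t) < r"
    using h(1) r(1) unfolding continuous_on_iff by (metis UNIV_I)
  show "\<exists>\<epsilon>>0. \<forall>u v. \<bar>u - t\<bar> < \<epsilon> \<and> \<bar>v - t\<bar> < \<epsilon> \<longrightarrow> hdist (h u) (h v) = \<bar>u - v\<bar>"
  proof (intro exI[of _ "min \<epsilon> d"] conjI allI impI)
    fix u v assume uv: "\<bar>u - t\<bar> < min \<epsilon> d \<and> \<bar>v - t\<bar> < min \<epsilon> d"
    then have "h u \<in> ball (h t) r" "h v \<in> ball (h t) r"
      using d(2)[of u] d(2)[of v] by (auto simp: dist_commute dist_real_def)
    then have "hdist (h u) (h v) = dist (\<omega> u) (\<omega> v)" using r(2) h(3) by metis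
    then show "hdist (h u) (h v) = \<bar>u - v\<bar>" using \<epsilon>(2) uv by auto
  qed (use \<epsilon> d in auto)
qed (use that in blast)

section \<open>Closed geodesics and deck transformations\<close>

lemma chart_inj:
  assumes "hyperbolic_chart S U f"
  shows "inj_on f U"
proof
  fix p q assume pq: "p \<in> U" "q \<in> U" "f p = f q"
  have "f q \<in> hplane" "hdist (f p) (f q) = dist p q"
    using assms pq(1,2) unfolding hyperbolic_chart_def by blast+
  then show "p = q" using pq(3) by (simp add: hdist_self)
qed

text \<open>A chart composed with the cover is a local isometry of the half-plane, hence a Moebius transformation
up to a reflection.\<close>

lemma chart_cover_conformal:
  assumes uc: "universal_cover S \<pi>" and ch: "hyperbolic_chart S U f" and z: "z \<in> hplane" "\<pi> z \<in> U"
  obtains r where "r > 0" "ball z r \<subseteq> hplane" "\<pi> ` ball z r \<subseteq> U" "inj_on (f \<circ> \<pi>) (ball z r)"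
    "(f \<circ> \<pi>) holomorphic_on ball z r \<or> (cnj \<circ> (f \<circ> \<pi>)) holomorphic_on ball z r"
proof -
  obtain r1 where r1: "r1 > 0" "ball z r1 \<subseteq> hplane"
    "\<And>v w. v \<in> ball z r1 \<Longrightarrow> w \<in> ball z r1 \<Longrightarrow> dist (\<pi> v) (\<pi> w) = hdist v w"
    using universal_cover_local_isometry[OF uc z(1)] by blast
  have "openin (top_of_set hplane) (hplane \<inter> \<pi> -` U)"
    using continuous_openin_preimage[of hplane \<pi> S U] universal_cover_simps[OF uc] ch
    by (auto simp: hyperbolic_chart_def)
  then have "open (hplane \<inter> \<pi> -` U)" using open_hplane by (metis openin_open_eq)
  then obtain r2 where r2: "r2 > 0" "ball z r2 \<subseteq> hplane \<inter> \<pi> -` U"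
    using z open_contains_ball by (metis IntI vimageI)
  define r where "r = min r1 r2"
  have r: "r > 0" "ball z r \<subseteq> hplane" "\<pi> ` ball z r \<subseteq> U" using r1 r2 by (auto simp: r_def)
  have iso: "hdist ((f \<circ> \<pi>) v) ((f \<circ> \<pi>) w) = hdist v w" if vw: "v \<in> ball z r" "w \<in> ball z r" for v w
  proof -
    have "hdist (f (\<pi> v)) (f (\<pi> w)) = dist (\<pi> v) (\<pi> w)"
      using vw r(3) ch unfolding hyperbolic_chart_def by (meson image_subset_iff)
    also have "\<dots> = hdist v w" using vw by (intro r1(3)) (auto simp: r_def)
    finally show ?thesis by simp
  qed
  have im: "(f \<circ> \<pi>) ` ball z r \<subseteq> hplane" using r(3) ch by (auto simp: hyperbolic_chart_def)
  have inj: "inj_on (f \<circ> \<pi>) (ball z r)"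
  proof
    fix v w assume vw: "v \<in> ball z r" "w \<in> ball z r" "(f \<circ> \<pi>) v = (f \<circ> \<pi>) w"
    then have "(f \<circ> \<pi>) w \<in> hplane" using im by blast
    then have "hdist v w = 0" using iso[OF vw(1,2)] vw(3) hdist_self by simp
    then show "v = w" using hdist_eq_0 vw r by blast
  qed
  define z1 where "z1 = z + of_real (r / 2)"
  have z1: "z1 \<in> ball z r" "z \<noteq> z1" "z \<in> ball z r" using r(1) by (auto simp: z1_def dist_norm)
  show ?thesis
  proof (rule isometry_moeb_or_reflected[OF r(2) im z1(3,1,2) iso])
    fix a b c d assume *: "a * d - b * c = 1" "\<And>w. w \<in> ball z r \<Longrightarrow> (f \<circ> \<pi>) w = moeb a b c d w"
    have "moeb a b c d holomorphic_on ball z r" using moeb_holomorphic[OF *(1)] r holomorphic_on_subset by blast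
    then have "(f \<circ> \<pi>) holomorphic_on ball z r" using *(2) holomorphic_cong by metis
    then show thesis using that r inj by blast
  next
    fix a b c d assume *: "a * d - b * c = 1" "\<And>w. w \<in> ball z r \<Longrightarrow> (f \<circ> \<pi>) w = moeb a b c d (- cnj w)"
    \<comment> \<open>Conjugation turns \<open>- cnj w\<close> into \<open>- w\<close>, as the matrix is real.\<close>
    have eq: "(cnj \<circ> (f \<circ> \<pi>)) w = (of_real b - of_real a * w) / (of_real d - of_real c * w)" if "w \<in> ball z r" for w
      using *(2)[OF that] by (simp add: moeb_def)
    have "of_real d - of_real c * w \<noteq> 0" if "w \<in> ball z r" for w
    proof -
      have "- cnj w \<in> hplane" using that r by (auto simp: hplane_def)
      then have "of_real c * (- cnj w) + of_real d \<noteq> 0" using moeb_denom[OF *(1)] by blast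
      then have "cnj (of_real c * (- cnj w) + of_real d) \<noteq> 0" by (simp only: complex_cnj_zero_iff not_False_eq_True)
      then show ?thesis by simp
    qed
    then have "(\<lambda>w. (of_real b - of_real a * w) / (of_real d - of_real c * w)) holomorphic_on ball z r"
      by (intro holomorphic_intros) auto
    then have "(cnj \<circ> (f \<circ> \<pi>)) holomorphic_on ball z r" using eq holomorphic_cong by (metis (no_types, lifting))
    then show thesis using that r inj by blast
  qed
qed

text \<open>If one chart is conformal and the other one anticonformal, then the change of charts has a conjugate linear
derivative, whose determinant is not positive. Injectivity makes the derivative of \<open>F\<close> nonzero, so that
this derivative can be computed from those of \<open>F\<close> and \<open>G\<close>.\<close>

lemma charts_same_orientation:
  assumes F: "F holomorphic_on ball z r" "inj_on F (ball z r)" and G: "(cnj \<circ> G) holomorphic_on ball z r"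
    and r: "r > 0" and V: "F z \<in> V" and h: "orientation_preserving_on V h"
    and eq: "\<And>w. w \<in> ball z r \<Longrightarrow> h (F w) = G w"
  shows False
proof -
  have zb: "z \<in> ball z r" using r by simp
  obtain D where D: "(h has_derivative D) (at (F z))" "Im (cnj (D 1) * D \<i>) > 0"
    using h V by (auto simp: orientation_preserving_on_def)
  define \<alpha> where "\<alpha> = deriv F z"
  have \<alpha>: "(F has_field_derivative \<alpha>) (at z)" "\<alpha> \<noteq> 0"
    using holomorphic_derivI[OF F(1) open_ball zb] holomorphic_injective_imp_regular[OF F(1) open_ball F(2) zb]
    by (auto simp: \<alpha>_def)
  obtain \<beta> where \<beta>: "((cnj \<circ> G) has_field_derivative \<beta>) (at z)"
    using holomorphic_derivI[OF G open_ball zb] by blast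
  have "((h \<circ> F) has_derivative D \<circ> (*) \<alpha>) (at z)"
    using \<alpha>(1) by (intro diff_chain_at D(1)) (simp add: has_field_derivative_def)
  then have "((cnj \<circ> (cnj \<circ> G)) has_derivative D \<circ> (*) \<alpha>) (at z)"
    by (rule has_derivative_transform_within_open[OF _ open_ball zb]) (use eq in auto)
  moreover have "((cnj \<circ> (cnj \<circ> G)) has_derivative cnj \<circ> (*) \<beta>) (at z)"
    using \<beta> bounded_linear_imp_has_derivative[OF bounded_linear_cnj]
    by (intro diff_chain_at) (auto simp: has_field_derivative_def)
  ultimately have "D \<circ> (*) \<alpha> = cnj \<circ> (*) \<beta>" by (rule has_derivative_unique)
  then have Dv: "D (\<alpha> * v) = cnj (\<beta> * v)" for v by (metis comp_apply)
  have "D 1 = cnj (\<beta> / \<alpha>)" "D \<i> = - \<i> * cnj (\<beta> / \<alpha>)"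
    using Dv[of "1 / \<alpha>"] Dv[of "\<i> / \<alpha>"] \<alpha>(2) by simp_all
  then have "cnj (D 1) * D \<i> = - \<i> * (\<beta> / \<alpha> * cnj (\<beta> / \<alpha>))" by simp
  also have "\<dots> = - \<i> * of_real ((cmod (\<beta> / \<alpha>))\<^sup>2)" by (simp only: complex_norm_square)
  finally have "Im (cnj (D 1) * D \<i>) \<le> 0" by simp
  then show False using D(2) by simp
qed

text \<open>By the previous lemma a point cannot be conformal for one chart of the atlas and anticonformal for
another one. Both kinds of points form open sets, so the connected half-plane consists of one kind. In
the anticonformal case conjugating all charts by \<^const>\<open>cnj\<close> makes them conformal; this is the map \<open>\<kappa>\<close>.\<close>

lemma orientable_cover_conformal:
  assumes uc: "universal_cover S \<pi>" and ori: "orientable_surface S"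
  shows "\<exists>\<A> \<kappa>. (\<forall>U f. (U, f) \<in> \<A> \<longrightarrow> hyperbolic_chart S U f) \<and>
    (\<forall>p\<in>S. \<exists>U f. (U, f) \<in> \<A> \<and> p \<in> U) \<and> inj \<kappa> \<and>
    (\<forall>U f z. (U, f) \<in> \<A> \<longrightarrow> z \<in> hplane \<longrightarrow> \<pi> z \<in> U \<longrightarrow>
       (\<exists>r>0. ball z r \<subseteq> hplane \<and> \<pi> ` ball z r \<subseteq> U \<and> (\<kappa> \<circ> (f \<circ> \<pi>)) holomorphic_on ball z r))"
proof -
  obtain \<A> where A: "\<And>U f. (U, f) \<in> \<A> \<Longrightarrow> hyperbolic_chart S U f"
    "\<And>p. p \<in> S \<Longrightarrow> \<exists>(U, f)\<in>\<A>. p \<in> U"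
    "\<And>U f V g. (U, f) \<in> \<A> \<Longrightarrow> (V, g) \<in> \<A> \<Longrightarrow> orientation_preserving_on (f ` (U \<inter> V)) (g \<circ> inv_into U f)"
    using ori unfolding orientable_surface_def by fast
  define conf where "conf \<kappa> z U f \<longleftrightarrow> (\<exists>r>0. ball z r \<subseteq> hplane \<and> \<pi> ` ball z r \<subseteq> U \<and>
    inj_on (f \<circ> \<pi>) (ball z r) \<and> (\<kappa> \<circ> (f \<circ> \<pi>)) holomorphic_on ball z r)" for \<kappa> :: "complex \<Rightarrow> complex" and z U f
  have dich: "conf id z U f \<or> conf cnj z U f" if "(U, f) \<in> \<A>" "z \<in> hplane" "\<pi> z \<in> U" for z U f
    using chart_cover_conformal[OF uc A(1)[OF that(1)] that(2,3)] unfolding conf_def id_comp by metis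
  have excl: False if fg: "(U, f) \<in> \<A>" "(V, g) \<in> \<A>" "conf id z U f" "conf cnj z V g" for z U f V g
  proof -
    obtain r1 where r1: "r1 > 0" "\<pi> ` ball z r1 \<subseteq> U" "inj_on (f \<circ> \<pi>) (ball z r1)" "(f \<circ> \<pi>) holomorphic_on ball z r1"
      using fg(3) unfolding conf_def id_comp by blast
    obtain r2 where r2: "r2 > 0" "\<pi> ` ball z r2 \<subseteq> V" "(cnj \<circ> (g \<circ> \<pi>)) holomorphic_on ball z r2"
      using fg(4) unfolding conf_def by blast
    define r where "r = min r1 r2"
    have r: "r > 0" "ball z r \<subseteq> ball z r1" "ball z r \<subseteq> ball z r2" using r1 r2 by (auto simp: r_def)
    have UV: "\<pi> w \<in> U \<inter> V" if "w \<in> ball z r" for w using r r1 r2 that by blast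
    show False
    proof (rule charts_same_orientation[of "f \<circ> \<pi>" z r "g \<circ> \<pi>" _ "g \<circ> inv_into U f"])
      show "(f \<circ> \<pi>) holomorphic_on ball z r" "inj_on (f \<circ> \<pi>) (ball z r)" "(cnj \<circ> (g \<circ> \<pi>)) holomorphic_on ball z r"
        using r r1 r2 holomorphic_on_subset inj_on_subset by metis+
      show "(f \<circ> \<pi>) z \<in> f ` (U \<inter> V)" using UV[of z] r(1) by auto
      show "orientation_preserving_on (f ` (U \<inter> V)) (g \<circ> inv_into U f)" using A(3) fg by blast
      show "(g \<circ> inv_into U f) ((f \<circ> \<pi>) w) = (g \<circ> \<pi>) w" if "w \<in> ball z r" for w
        using inv_into_f_f[OF chart_inj[OF A(1)[OF \<open>(U, f) \<in> \<A>\<close>]]] UV[OF that] by simp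
    qed (use r in auto)
  qed
  define P where "P \<kappa> = {z \<in> hplane. \<exists>U f. (U, f) \<in> \<A> \<and> conf \<kappa> z U f}" for \<kappa>
  have openP: "open (P \<kappa>)" for \<kappa>
    unfolding open_contains_ball
  proof
    fix z assume "z \<in> P \<kappa>"
    then obtain U f r where z: "z \<in> hplane" "(U, f) \<in> \<A>" "r > 0" "ball z r \<subseteq> hplane" "\<pi> ` ball z r \<subseteq> U"
      "inj_on (f \<circ> \<pi>) (ball z r)" "(\<kappa> \<circ> (f \<circ> \<pi>)) holomorphic_on ball z r"
      unfolding P_def conf_def by blast
    have "w \<in> P \<kappa>" if w: "w \<in> ball z r" for w
    proof -
      obtain s where s: "s > 0" and sub: "ball w s \<subseteq> ball z r"
        using w open_ball open_contains_ball by metis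
      have "ball w s \<subseteq> hplane" "\<pi> ` ball w s \<subseteq> U" using z(4,5) sub by blast+
      then have "conf \<kappa> w U f" unfolding conf_def
        using s inj_on_subset[OF z(6) sub] holomorphic_on_subset[OF z(7) sub] by blast
      then show ?thesis using z(2,4) w unfolding P_def by blast
    qed
    then show "\<exists>e>0. ball z e \<subseteq> P \<kappa>" using z(3) by blast
  qed
  have "P id \<inter> P cnj = {}" using excl unfolding P_def by blast
  moreover have cover: "hplane \<subseteq> P id \<union> P cnj"
  proof
    fix z assume z: "z \<in> hplane"
    then have "\<pi> z \<in> S" using universal_cover_simps(3)[OF uc] by blast
    then obtain U f where "(U, f) \<in> \<A>" "\<pi> z \<in> U" using A(2) by blast
    then have "conf id z U f \<or> conf cnj z U f" using dich z by blast
    then show "z \<in> P id \<union> P cnj" using z \<open>(U, f) \<in> \<A>\<close> unfolding P_def by blast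
  qed
  moreover have "connected hplane" by (simp add: convex_hplane convex_connected)
  ultimately have "P id \<inter> hplane = {} \<or> P cnj \<inter> hplane = {}"
    using connectedD[of hplane "P id" "P cnj"] openP by blast
  moreover have mem: "z \<in> P \<kappa> \<inter> hplane" if "conf \<kappa> z U f" "z \<in> hplane" "(U, f) \<in> \<A>" for \<kappa> z U f
    using that unfolding P_def by blast
  ultimately obtain \<kappa> where \<kappa>: "\<kappa> = id \<or> \<kappa> = cnj"
    "\<And>z U f. z \<in> hplane \<Longrightarrow> (U, f) \<in> \<A> \<Longrightarrow> \<pi> z \<in> U \<Longrightarrow> conf \<kappa> z U f"
    using dich by (metis empty_iff)
  show ?thesis
  proof (intro exI[of _ \<A>] exI[of _ \<kappa>] conjI allI impI ballI)
    show "inj \<kappa>" using \<kappa>(1) by (auto simp: inj_def)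
    show "\<exists>U f. (U, f) \<in> \<A> \<and> p \<in> U" if "p \<in> S" for p using A(2)[OF that] by blast
    show "\<exists>r>0. ball z r \<subseteq> hplane \<and> \<pi> ` ball z r \<subseteq> U \<and> (\<kappa> \<circ> (f \<circ> \<pi>)) holomorphic_on ball z r"
      if "(U, f) \<in> \<A>" "z \<in> hplane" "\<pi> z \<in> U" for U f z
      using \<kappa>(2)[OF that(2,1,3)] unfolding conf_def by blast
  qed (use A(1) in blast)
qed

text \<open>In oriented charts \<open>\<pi>\<close> and its composition with the transformation are holomorphic, so the identity
theorem applies: the set of accumulation points of their coincidence set is open and closed.\<close>

lemma deck_transformation_extends:
  assumes uc: "universal_cover S \<pi>" and ori: "orientable_surface S"
    and T: "a * d - b * c = 1" and z0: "z0 \<in> hplane" "z0 islimpt {w \<in> hplane. \<pi> (moeb a b c d w) = \<pi> w}"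
    and z: "z \<in> hplane"
  shows "\<pi> (moeb a b c d z) = \<pi> z"
proof -
  obtain \<A> \<kappa> where A: "\<And>U f. (U, f) \<in> \<A> \<Longrightarrow> hyperbolic_chart S U f"
    "\<And>p. p \<in> S \<Longrightarrow> \<exists>U f. (U, f) \<in> \<A> \<and> p \<in> U" "inj \<kappa>"
    "\<And>U f z. (U, f) \<in> \<A> \<Longrightarrow> z \<in> hplane \<Longrightarrow> \<pi> z \<in> U \<Longrightarrow>
       \<exists>r>0. ball z r \<subseteq> hplane \<and> \<pi> ` ball z r \<subseteq> U \<and> (\<kappa> \<circ> (f \<circ> \<pi>)) holomorphic_on ball z r"
    using orientable_cover_conformal[OF uc ori] by metis
  let ?T = "moeb a b c d"
  define W where "W = {w \<in> hplane. \<pi> (?T w) = \<pi> w}"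
  define E where "E = {z \<in> hplane. z islimpt W}"
  have cT: "continuous_on hplane ?T" using moeb_holomorphic[OF T] by (rule holomorphic_on_imp_continuous_on)
  have Th: "?T ` hplane \<subseteq> hplane" using moeb_hplane[OF T] by auto
  have c\<pi>: "continuous_on hplane \<pi>" using universal_cover_simps[OF uc] by simp
  have "continuous_on hplane (\<lambda>w. dist (\<pi> (?T w)) (\<pi> w))"
    using c\<pi> continuous_on_compose2[OF c\<pi> cT Th] by (intro continuous_intros)
  then have "closedin (top_of_set hplane) {w \<in> hplane. dist (\<pi> (?T w)) (\<pi> w) = 0}"
    by (rule continuous_closedin_preimage_constant)
  then have clW: "closedin (top_of_set hplane) W" by (simp add: W_def)
  then have EW: "E \<subseteq> W" unfolding closedin_limpt E_def by blast
  have "open E"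
    unfolding open_contains_ball
  proof
    fix z assume zE: "z \<in> E"
    then have z: "z \<in> hplane" "\<pi> (?T z) = \<pi> z" using EW by (auto simp: W_def E_def)
    have Tz: "?T z \<in> hplane" using Th z by blast
    obtain U f where U: "(U, f) \<in> \<A>" "\<pi> z \<in> U"
      using A(2) universal_cover_simps(3)[OF uc] z(1) by blast
    obtain r1 where r1: "r1 > 0" "ball z r1 \<subseteq> hplane" "\<pi> ` ball z r1 \<subseteq> U" "(\<kappa> \<circ> (f \<circ> \<pi>)) holomorphic_on ball z r1"
      using A(4)[OF U(1) z(1) U(2)] by blast
    obtain r2 where r2: "r2 > 0" "\<pi> ` ball (?T z) r2 \<subseteq> U" "(\<kappa> \<circ> (f \<circ> \<pi>)) holomorphic_on ball (?T z) r2"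
      using A(4)[OF U(1) Tz] U(2) z(2) by auto
    have "open (hplane \<inter> ?T -` ball (?T z) r2)"
      using continuous_open_preimage[OF cT open_hplane open_ball] .
    then obtain r3 where r3: "r3 > 0" "ball z r3 \<subseteq> hplane \<inter> ?T -` ball (?T z) r2"
      using z(1) r2(1) unfolding open_contains_ball by (metis IntI centre_in_ball vimageI)
    define r where "r = min r1 r3"
    have r: "r > 0" "ball z r \<subseteq> ball z r1" "ball z r \<subseteq> ball z r3" using r1 r3 by (auto simp: r_def)
    define G where "G w = (\<kappa> \<circ> (f \<circ> \<pi>)) w - (\<kappa> \<circ> (f \<circ> \<pi>)) (?T w)" for w
    have "?T holomorphic_on ball z r" using moeb_holomorphic[OF T] r(2) r1(2) holomorphic_on_subset by blast
    moreover have "?T ` ball z r \<subseteq> ball (?T z) r2" using r(3) r3(2) by blast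
    ultimately have "((\<kappa> \<circ> (f \<circ> \<pi>)) \<circ> ?T) holomorphic_on ball z r"
      using holomorphic_on_compose_gen r2(3) by blast
    then have G: "G holomorphic_on ball z r"
      unfolding G_def using holomorphic_on_subset[OF r1(4) r(2)]
      by (intro holomorphic_intros) (simp_all add: o_def)
    have "ball z r \<subseteq> W"
    proof
      fix w assume w: "w \<in> ball z r"
      have "z islimpt W" using zE by (simp add: E_def)
      then have lim: "z islimpt (W \<inter> ball z r)"
        using r(1) by (intro islimpt_Int_eventually eventually_at_in_open') auto
      have "G w = 0"
        by (rule analytic_continuation[OF G open_ball connected_ball _ _ lim _ w])
           (use r(1) in \<open>auto simp: G_def W_def\<close>)
      then have "f (\<pi> w) = f (\<pi> (?T w))" using A(3) by (simp add: G_def inj_eq)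
      moreover have "\<pi> w \<in> U" "\<pi> (?T w) \<in> U" using w r r1(3) r2(2) r3(2) by blast+
      ultimately have "\<pi> (?T w) = \<pi> w" using chart_inj[OF A(1)[OF U(1)]] by (metis inj_onD)
      then show "w \<in> W" using w r(2) r1(2) by (auto simp: W_def)
    qed
    then have "ball z r \<subseteq> E"
      using r(2) r1(2) interior_limit_point[of _ "ball z r"] islimpt_subset[of _ "ball z r" W]
      unfolding E_def by (auto simp: interior_open)
    then show "\<exists>e>0. ball z e \<subseteq> E" using r(1) by blast
  qed
  then have "openin (top_of_set hplane) E"
    using open_hplane by (auto simp: E_def openin_open_eq)
  moreover have "closedin (top_of_set hplane) E"
  proof -
    have "E = hplane \<inter> {x. x islimpt W}" by (auto simp: E_def)
    then show ?thesis by (simp add: closedin_closed_Int closed_limpts)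
  qed
  moreover have "connected hplane" by (simp add: convex_hplane convex_connected)
  moreover have "z0 \<in> E" using z0 by (simp add: E_def W_def)
  ultimately have "E = hplane" unfolding connected_clopen by blast
  then show ?thesis using EW z by (auto simp: W_def)
qed

text \<open>The matrix is the conjugate of the diagonal matrix with entries \<open>e\<close> and \<open>1 / e\<close> by the matrix of
\<open>a, b, c, d\<close>. With \<open>e = exp (l / 2)\<close> it is the translation by \<open>l\<close> along the image of the axis.\<close>

lemma moeb_translation:
  assumes det: "a * d - b * c = 1" and e: "e > (0::real)"
  shows "(a * d * e - b * c / e) * (a * d / e - b * c * e) - (- (a * b * (e - 1 / e))) * (c * d * (e - 1 / e)) = 1"
    and "z \<in> hplane \<Longrightarrow> moeb (a * d * e - b * c / e) (- (a * b * (e - 1 / e))) (c * d * (e - 1 / e)) (a * d / e - b * c * e)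
       (moeb a b c d z) = moeb a b c d (of_real (e\<^sup>2) * z)"
proof -
  have ee: "e * (1 / e) = 1" using e by simp
  define i where "i = 1 / e"
  have i: "e * i = 1" "x / e = x * i" for x using e by (auto simp: i_def)
  have "(a * d * e - b * c * i) * (a * d * i - b * c * e) - (- (a * b * (e - i))) * (c * d * (e - i))
      = (a * d - b * c)\<^sup>2 * (e * i)"
    by (simp add: power2_eq_square algebra_simps)
  then have "(a * d * e - b * c * i) * (a * d * i - b * c * e) - (- (a * b * (e - i))) * (c * d * (e - i)) = 1"
    by (simp only: i(1) det) simp
  then show 1: "(a * d * e - b * c / e) * (a * d / e - b * c * e) - (- (a * b * (e - 1 / e))) * (c * d * (e - 1 / e)) = 1"
    by (simp add: i)
  assume z: "z \<in> hplane"
  have d': "e * i - 0 * 0 = 1" using i by simp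
  have x: "(a * d * e - b * c * i) * a + (- (a * b * (e - i))) * c = a * e"
    "(a * d * e - b * c * i) * b + (- (a * b * (e - i))) * d = b * i"
    "(c * d * (e - i)) * a + (a * d * i - b * c * e) * c = c * e"
    "(c * d * (e - i)) * b + (a * d * i - b * c * e) * d = d * i"
  proof -
    have "(a * d * e - b * c * i) * a + (- (a * b * (e - i))) * c = a * e * (a * d - b * c)"
      "(a * d * e - b * c * i) * b + (- (a * b * (e - i))) * d = b * i * (a * d - b * c)"
      "(c * d * (e - i)) * a + (a * d * i - b * c * e) * c = c * e * (a * d - b * c)"
      "(c * d * (e - i)) * b + (a * d * i - b * c * e) * d = d * i * (a * d - b * c)"
      by (simp_all add: algebra_simps)
    then show "(a * d * e - b * c * i) * a + (- (a * b * (e - i))) * c = a * e"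
      "(a * d * e - b * c * i) * b + (- (a * b * (e - i))) * d = b * i"
      "(c * d * (e - i)) * a + (a * d * i - b * c * e) * c = c * e"
      "(c * d * (e - i)) * b + (a * d * i - b * c * e) * d = d * i"
      by (simp_all only: det mult_1_right)
  qed
  have "moeb (a * d * e - b * c * i) (- (a * b * (e - i))) (c * d * (e - i)) (a * d * i - b * c * e) (moeb a b c d z)
     = moeb (a * e) (b * i) (c * e) (d * i) z"
    unfolding moeb_moeb[OF det z] x ..
  also have "\<dots> = moeb a b c d (moeb e 0 0 i z)"
    unfolding moeb_moeb[OF d' z] by simp
  also have "moeb e 0 0 i z = of_real (e\<^sup>2) * z"
    using e by (simp add: moeb_def i_def power2_eq_square)
  finally show "moeb (a * d * e - b * c / e) (- (a * b * (e - 1 / e))) (c * d * (e - 1 / e)) (a * d / e - b * c * e)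
       (moeb a b c d z) = moeb a b c d (of_real (e\<^sup>2) * z)" by (simp add: i)
qed

text \<open>The translation along the lift maps the point at time \<open>t\<close> to the point at time \<open>t + l\<close>, so the
cover does not distinguish a point of the lift from its image; the previous results spread this from
the lift to the whole plane. In the coordinates given by \<open>moeb a b c d\<close> the translation is a dilation.\<close>

lemma closed_geodesic_deck_transformation:
  assumes uc: "universal_cover S \<pi>" and ori: "orientable_surface S" and \<omega>: "closed_geodesic S \<omega> l"
    and det: "a * d - b * c = 1" and lift: "\<And>t. \<pi> (moeb a b c d (vert t)) = \<omega> t"
    and z: "z \<in> hplane"
  shows "\<pi> (moeb a b c d (of_real ((exp (l / 2))\<^sup>2) * z)) = \<pi> (moeb a b c d z)"
proof -
  define e where "e = exp (l / 2)"
  have e: "e > 0" by (simp add: e_def)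
  let ?M = "moeb a b c d"
  let ?A = "a * d * e - b * c / e" and ?B = "- (a * b * (e - 1 / e))" and ?C = "c * d * (e - 1 / e)" and ?D = "a * d / e - b * c * e"
  note T = moeb_translation[OF det e]
  have shift: "of_real (e\<^sup>2) * vert t = vert (t + l)" for t
    by (simp add: e_def vert_def complex_eq_iff exp_add exp_double[symmetric])
  have inv: "\<pi> (moeb ?A ?B ?C ?D (?M (vert t))) = \<pi> (?M (vert t))" for t
    using T(2)[OF vert_hplane] lift \<omega> shift by (simp add: closed_geodesic_def)
  have cont: "continuous_on UNIV (\<lambda>t. ?M (vert t))"
    by (rule continuous_on_compose2[OF moeb_continuous[OF det] vert_continuous]) auto
  have "\<pi> (moeb ?A ?B ?C ?D (?M z)) = \<pi> (?M z)"
  proof (rule deck_transformation_extends[OF uc ori T(1)])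
    show "?M (vert 0) \<in> hplane" "?M z \<in> hplane" using moeb_hplane[OF det] z by auto
    show "?M (vert 0) islimpt {w \<in> hplane. \<pi> (moeb ?A ?B ?C ?D w) = \<pi> w}"
      unfolding islimpt_approachable
    proof (intro allI impI)
      fix \<epsilon> :: real assume "\<epsilon> > 0"
      then obtain r where r: "r > 0" "\<And>t. dist t 0 < r \<Longrightarrow> dist (?M (vert t)) (?M (vert 0)) < \<epsilon>"
        using cont unfolding continuous_on_iff by (metis UNIV_I)
      have "hdist (?M (vert (r / 2))) (?M (vert 0)) = r / 2" using hdist_geodesic[OF det] r(1) by simp
      then have "?M (vert (r / 2)) \<noteq> ?M (vert 0)" using r(1) hdist_self moeb_hplane[OF det] by fastforce
      moreover have "dist (?M (vert (r / 2))) (?M (vert 0)) < \<epsilon>" using r by simp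
      ultimately show "\<exists>x'\<in>{w \<in> hplane. \<pi> (moeb ?A ?B ?C ?D w) = \<pi> w}. x' \<noteq> ?M (vert 0) \<and> dist x' (?M (vert 0)) < \<epsilon>"
        using inv moeb_hplane[OF det] by (intro bexI[of _ "?M (vert (r / 2))"]) auto
    qed
  qed
  then show ?thesis using T(2)[OF z] by (simp add: e_def)
qed

lemma relative_translation_invariant:
  fixes p :: "complex \<Rightarrow> 'a"
  assumes N: "a * d - b * c = 1" and e: "e > (0::real)"
    and inv: "\<And>w. w \<in> hplane \<Longrightarrow> p (moeb a b c d (of_real (e\<^sup>2) * w)) = p (moeb a b c d w)"
    and z: "z \<in> hplane"
  shows "p (moeb (a * d * e - b * c / e) (- (a * b * (e - 1 / e))) (c * d * (e - 1 / e)) (a * d / e - b * c * e) z) = p z"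
proof -
  have N': "d * a - (- b) * (- c) = 1" using N by (simp add: mult.commute)
  define w where "w = moeb d (- b) (- c) a z"
  have w: "w \<in> hplane" "moeb a b c d w = z"
    using moeb_hplane[OF N' z] moeb_inv2[OF N z] by (auto simp: w_def)
  then show ?thesis using moeb_translation(2)[OF N e w(1)] inv[OF w(1)] by simp
qed

section \<open>Moebius transformations that preserve a locally injective map\<close>

text \<open>This property of the covering map excludes fixed points of deck transformations. It is stated for
arbitrary maps because the cover will be composed with isometries and inversions.\<close>

definition locally_injective :: "(complex \<Rightarrow> 'a) \<Rightarrow> bool" where
  "locally_injective p \<longleftrightarrow>
     (\<forall>z\<in>hplane. \<exists>r>0. ball z r \<subseteq> hplane \<and> inj_on p (ball z r))"

lemma universal_cover_locally_injective:
  assumes uc: "universal_cover S \<pi>" and det: "a * d - b * c = 1"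
  shows "locally_injective (\<lambda>z. \<pi> (moeb a b c d z))"
  unfolding locally_injective_def
proof
  fix z assume z: "z \<in> hplane"
  obtain r where r: "r > 0" "ball (moeb a b c d z) r \<subseteq> hplane"
    "\<And>v w. v \<in> ball (moeb a b c d z) r \<Longrightarrow> w \<in> ball (moeb a b c d z) r \<Longrightarrow> dist (\<pi> v) (\<pi> w) = hdist v w"
    using universal_cover_local_isometry[OF uc moeb_hplane[OF det z]] by metis
  have "open (hplane \<inter> moeb a b c d -` ball (moeb a b c d z) r)"
    by (rule continuous_open_preimage[OF moeb_continuous[OF det] open_hplane open_ball])
  then obtain s where s: "s > 0" "ball z s \<subseteq> hplane \<inter> moeb a b c d -` ball (moeb a b c d z) r"
    using z r(1) unfolding open_contains_ball by (metis IntI centre_in_ball vimageI)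
  have "inj_on (\<lambda>z. \<pi> (moeb a b c d z)) (ball z s)"
  proof
    fix v w assume vw: "v \<in> ball z s" "w \<in> ball z s" "\<pi> (moeb a b c d v) = \<pi> (moeb a b c d w)"
    then have b: "moeb a b c d v \<in> ball (moeb a b c d z) r" "moeb a b c d w \<in> ball (moeb a b c d z) r"
      and h: "v \<in> hplane" "w \<in> hplane" using s(2) by blast+
    have "hdist v w = 0" using r(3)[OF b] vw(3) hdist_moeb[OF det h] by simp
    then show "v = w" using hdist_eq_0[OF h] by simp
  qed
  then show "\<exists>r>0. ball z r \<subseteq> hplane \<and> inj_on (\<lambda>z. \<pi> (moeb a b c d z)) (ball z r)"
    using s by blast
qed

text \<open>Near a fixed point, local injectivity makes every point a fixed point. The fixed points are the
zeros of a quadratic polynomial, which vanishes as it has three zeros.\<close>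

lemma invariant_with_fixed_point:
  assumes li: "locally_injective p" and det: "a * d - b * c = 1"
    and inv: "\<And>z. z \<in> hplane \<Longrightarrow> p (moeb a b c d z) = p z"
    and z: "z \<in> hplane" "moeb a b c d z = z"
  shows "b = 0 \<and> c = 0 \<and> a = d"
proof -
  obtain r where r: "r > 0" "ball z r \<subseteq> hplane" "inj_on p (ball z r)"
    using li z unfolding locally_injective_def by blast
  have "isCont (moeb a b c d) z"
    unfolding moeb_def using moeb_denom[OF det z(1)] by (intro continuous_intros) auto
  then obtain s where s: "s > 0" "\<And>w. dist w z < s \<Longrightarrow> dist (moeb a b c d w) (moeb a b c d z) < r"
    using r(1) unfolding continuous_at_eps_delta by (metis dist_norm continuous_at_eps_delta)
  define x where "x = min r s / 3"
  have x: "x > 0" "x < r" "2 * x < r" "x < s" "2 * x < s" using r s by (auto simp: x_def)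
  have fixed: "of_real c * (z + of_real y)\<^sup>2 + of_real (d - a) * (z + of_real y) - of_real b = 0"
    if "0 \<le> y" "y < r" "y < s" for y
  proof -
    define w where "w = z + of_real y"
    have d: "dist w z = y" using that by (simp add: w_def dist_norm)
    have w: "w \<in> hplane" using d that r(2) by (auto simp: dist_commute)
    have "dist (moeb a b c d w) z < r" using s(2)[of w] d that z by simp
    then have "moeb a b c d w = w"
      using inj_onD[OF r(3) inv[OF w]] d that by (simp add: dist_commute)
    then have "of_real a * w + of_real b = w * (of_real c * w + of_real d)"
      using moeb_denom[OF det w] by (simp add: moeb_def divide_eq_eq)
    then show ?thesis unfolding w_def by (simp add: power2_eq_square algebra_simps)
  qed
  have e0: "of_real c * z\<^sup>2 + of_real (d - a) * z - of_real b = 0" using fixed[of 0] r s by simp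
  have e1: "of_real c * (z + of_real x)\<^sup>2 + of_real (d - a) * (z + of_real x) - of_real b = 0"
    using fixed[of x] x by simp
  have e2: "of_real c * (z + 2 * of_real x)\<^sup>2 + of_real (d - a) * (z + 2 * of_real x) - of_real b = 0"
    using fixed[of "2 * x"] x by simp
  \<comment> \<open>The second difference of the quadratic polynomial.\<close>
  have "of_real c * (of_real x)\<^sup>2 * 2 = (0::complex)" using e0 e1 e2 by algebra
  then have c: "c = 0" using x by simp
  then have "of_real (d - a) * of_real x = (0::complex)" using e0 e1 by (simp add: algebra_simps)
  then have "d = a" using x by simp
  then show ?thesis using c e0 by simp
qed

lemma elliptic_fixed_point:
  assumes det: "a * d - b * c = 1" and tr: "\<bar>a + d\<bar> < 2"
  shows "\<exists>z\<in>hplane. moeb a b c d z = z"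
proof -
  have "(a + d)\<^sup>2 < 2\<^sup>2" using tr by (intro power2_strict_mono) auto
  then have D: "4 - (a + d)\<^sup>2 > 0" by simp
  have c: "c \<noteq> 0"
  proof
    assume "c = 0"
    then have "(a + d)\<^sup>2 = (a - d)\<^sup>2 + 4" using det by (simp add: power2_eq_square algebra_simps)
    then show False using D zero_le_power2[of "a - d"] by linarith
  qed
  define x y where "x = (a - d) / (2 * c)" and "y = sqrt (4 - (a + d)\<^sup>2) / (2 * \<bar>c\<bar>)"
  have y: "y > 0" using D c by (simp add: y_def)
  have x: "2 * c * x = a - d" using c by (simp add: x_def)
  have y2: "4 * c\<^sup>2 * y\<^sup>2 = 4 - (a + d)\<^sup>2" using D c by (simp add: y_def power_divide power_mult_distrib)
  define z where "z = Complex x y"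
  have zh: "z \<in> hplane" using y by (simp add: z_def hplane_def)
  have "4 * c * (c * (x\<^sup>2 - y\<^sup>2) + (d - a) * x - b) = 0"
  proof -
    have "4 * c * (c * (x\<^sup>2 - y\<^sup>2) + (d - a) * x - b) = (2 * c * x)\<^sup>2 - 4 * c\<^sup>2 * y\<^sup>2 + 2 * (d - a) * (2 * c * x) - 4 * b * c"
      by (simp add: power2_eq_square algebra_simps)
    also have "\<dots> = 4 * (a * d - b * c) - 4" unfolding x y2 by (simp add: power2_eq_square algebra_simps)
    finally show ?thesis using det by simp
  qed
  then have re: "c * (x\<^sup>2 - y\<^sup>2) + (d - a) * x - b = 0" using c by simp
  have "c * (2 * x * y) + (d - a) * y = (2 * c * x + (d - a)) * y" by (simp add: algebra_simps)
  then have im: "c * (2 * x * y) + (d - a) * y = 0" unfolding x by simp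
  have "of_real a * z + of_real b = z * (of_real c * z + of_real d)"
    using re im by (simp add: complex_eq_iff z_def power2_eq_square algebra_simps)
  then have "moeb a b c d z = z" using moeb_denom[OF det zh] by (simp add: moeb_def divide_eq_eq)
  then show ?thesis using zh by blast
qed

lemma invariant_trace:
  assumes li: "locally_injective p" and det: "a * d - b * c = 1"
    and inv: "\<And>z. z \<in> hplane \<Longrightarrow> p (moeb a b c d z) = p z"
  shows "\<bar>a + d\<bar> \<ge> 2"
proof (rule ccontr)
  assume lt: "\<not> \<bar>a + d\<bar> \<ge> 2"
  then obtain z where "z \<in> hplane" "moeb a b c d z = z" using elliptic_fixed_point[OF det] by auto
  then have "b = 0" "a = d" using invariant_with_fixed_point[OF li det inv] by auto
  then have "a\<^sup>2 = 1" using det by (simp add: power2_eq_square)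
  then show False using lt \<open>a = d\<close> by (auto simp: power2_eq_1_iff)
qed

lemma of_real_mult_hplane: "k > 0 \<Longrightarrow> z \<in> hplane \<Longrightarrow> of_real k * z \<in> hplane"
  by (simp add: hplane_def)

lemma add_of_real_hplane: "z \<in> hplane \<Longrightarrow> z + of_real x \<in> hplane"
  by (simp add: hplane_def)

text \<open>The commutator of the dilation and the affine map is a translation. Conjugating it with
powers of the dilation yields arbitrarily small translations, which have to be trivial by local injectivity
at \<open>\<i>\<close>. Geometrically, a hyperbolic deck transformation shares its fixed point at infinity only
with transformations that share its axis.\<close>

lemma invariant_affine:
  assumes li: "locally_injective p" and k: "k > 1" and dil: "\<And>z. z \<in> hplane \<Longrightarrow> p (of_real k * z) = p z"
    and s: "s > 0" and aff: "\<And>z. z \<in> hplane \<Longrightarrow> p (of_real s * z + of_real t) = p z"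
  shows "t = 0"
proof -
  \<comment> \<open>The translation length of the commutator.\<close>
  define \<beta> where "\<beta> = t * (k - 1)"
  have transl: "p (z + of_real \<beta>) = p z" if z: "z \<in> hplane" for z
  proof -
    define w where "w = of_real (1 / (k * s)) * (z + of_real (- t))"
    have w: "w \<in> hplane" unfolding w_def using z k s by (intro of_real_mult_hplane add_of_real_hplane) auto
    have kw: "of_real k * w \<in> hplane" and sw: "of_real s * w + of_real t \<in> hplane"
      using w k s by (auto intro: of_real_mult_hplane add_of_real_hplane)
    have z1: "of_real s * (of_real k * w) + of_real t = z" using k s by (simp add: w_def field_simps)
    have "p z = p w" using aff[OF kw] dil[OF w] z1 by simp
    also have "\<dots> = p (of_real k * (of_real s * w + of_real t))" using dil[OF sw] aff[OF w] by simp
    also have "of_real k * (of_real s * w + of_real t) = z + of_real \<beta>"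
      using k s by (simp add: w_def \<beta>_def field_simps)
    finally show ?thesis by simp
  qed
  have dil_pow: "p (of_real (k ^ n) * z) = p z" if "z \<in> hplane" for n z
  proof (induction n)
    case (Suc n)
    have "of_real (k ^ n) * z \<in> hplane" using k that by (intro of_real_mult_hplane) auto
    then show ?case using dil Suc by (metis mult.assoc of_real_mult power_Suc)
  qed simp
  have small: "p (\<i> + of_real (\<beta> / k ^ n)) = p \<i>" for n
  proof -
    have "p \<i> = p (of_real (k ^ n) * \<i> + of_real \<beta>)"
      using dil_pow[OF ii_hplane] transl of_real_mult_hplane[OF _ ii_hplane, of "k ^ n"] k by simp
    also have "of_real (k ^ n) * \<i> + of_real \<beta> = of_real (k ^ n) * (\<i> + of_real (\<beta> / k ^ n))"
      using k by (simp add: field_simps)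
    also have "p \<dots> = p (\<i> + of_real (\<beta> / k ^ n))" by (intro dil_pow add_of_real_hplane ii_hplane)
    finally show ?thesis by simp
  qed
  obtain r where r: "r > 0" "inj_on p (ball \<i> r)"
    using li unfolding locally_injective_def by (meson ii_hplane)
  obtain n where "\<bar>\<beta>\<bar> / r < k ^ n" using real_arch_pow[OF k] by blast
  then have "\<bar>\<beta> / k ^ n\<bar> < r" using r k by (simp add: field_simps)
  moreover have "dist \<i> (\<i> + of_real x) = \<bar>x\<bar>" for x by (simp add: dist_norm)
  ultimately have "\<i> + of_real (\<beta> / k ^ n) \<in> ball \<i> r" by (simp only: mem_ball)
  then have "\<i> + of_real (\<beta> / k ^ n) = \<i>" using inj_onD[OF r(2) small] r(1) by simp
  then show ?thesis using k by (simp add: \<beta>_def)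
qed

text \<open>Such a transformation fixes the endpoint \<open>\<infinity>\<close> of the axis.\<close>

lemma invariant_upper_triangular:
  assumes li: "locally_injective p" and k: "k > 1" and dil: "\<And>z. z \<in> hplane \<Longrightarrow> p (of_real k * z) = p z"
    and det: "a * d = 1" and inv: "\<And>z. z \<in> hplane \<Longrightarrow> p (moeb a b 0 d z) = p z"
  shows "b = 0"
proof -
  have d: "d \<noteq> 0" "a \<noteq> 0" "a / d > 0" using det by (auto simp: zero_less_divide_iff zero_less_mult_iff dest: arg_cong[of _ _ "\<lambda>x. x > 0"])
  have "moeb a b 0 d z = of_real (a / d) * z + of_real (b / d)" for z
    using d by (simp add: moeb_def field_simps)
  then have "p (of_real (a / d) * z + of_real (b / d)) = p z" if "z \<in> hplane" for z
    using inv[OF that] by metis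
  then have "b / d = 0" using invariant_affine[OF li k dil d(3)] by blast
  then show ?thesis using d by simp
qed

text \<open>The inversion \<open>z \<mapsto> - 1 / z\<close> exchanges the endpoints \<open>0\<close> and \<open>\<infinity>\<close> of the axis.\<close>

lemma invariant_lower_triangular:
  assumes li: "locally_injective p" and k: "k > 1" and dil: "\<And>z. z \<in> hplane \<Longrightarrow> p (of_real k * z) = p z"
    and det: "a * d = 1" and inv: "\<And>z. z \<in> hplane \<Longrightarrow> p (moeb a 0 c d z) = p z"
  shows "c = 0"
proof -
  define q where "q z = p (- (1 / z))" for z
  have J: "- (1 / z) \<in> hplane" if "z \<in> hplane" for z
    using that by (auto simp: hplane_def Im_divide)
      (metis complex_eq_0 divide_pos_pos less_irrefl sum_power2_gt_zero_iff)
  have nz: "z \<noteq> 0" if "z \<in> hplane" for z using that by (auto simp: hplane_def)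
  have liq: "locally_injective q"
    unfolding locally_injective_def
  proof
    fix z assume z: "z \<in> hplane"
    obtain r where r: "r > 0" "inj_on p (ball (- (1 / z)) r)"
      using li J[OF z] unfolding locally_injective_def by meson
    have "continuous_on hplane (\<lambda>z. - (1 / z))" using nz by (intro continuous_intros) auto
    then have "open (hplane \<inter> (\<lambda>z. - (1 / z)) -` ball (- (1 / z)) r)"
      by (rule continuous_open_preimage[OF _ open_hplane open_ball])
    then obtain s where s: "s > 0" "ball z s \<subseteq> hplane \<inter> (\<lambda>z. - (1 / z)) -` ball (- (1 / z)) r"
      using z r(1) unfolding open_contains_ball by (metis IntI centre_in_ball vimageI)
    have "inj_on q (ball z s)"
    proof
      fix v w assume vw: "v \<in> ball z s" "w \<in> ball z s" "q v = q w"
      then have "- (1 / v) \<in> ball (- (1 / z)) r" "- (1 / w) \<in> ball (- (1 / z)) r" using s(2) by blast+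
      then have "- (1 / v) = - (1 / w)" using vw(3) r(2) unfolding q_def by (meson inj_onD)
      moreover have "v \<noteq> 0" "w \<noteq> 0" using vw s(2) nz by blast+
      ultimately show "v = w" by simp
    qed
    then show "\<exists>r>0. ball z r \<subseteq> hplane \<and> inj_on q (ball z r)" using s by blast
  qed
  have dilq: "q (of_real k * z) = q z" if z: "z \<in> hplane" for z
  proof -
    have "of_real k * z \<in> hplane" using z k by (intro of_real_mult_hplane) auto
    then have "p (of_real k * (- (1 / (of_real k * z)))) = p (- (1 / (of_real k * z)))" by (intro dil J)
    moreover have "of_real k * (- (1 / (of_real k * z))) = - (1 / z)" using k nz[OF z] by simp
    ultimately show ?thesis by (simp add: q_def)
  qed
  have d: "d \<noteq> 0" "a \<noteq> 0" using det by auto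
  have det': "d * a = 1" using det by (simp add: mult.commute)
  have "q (moeb d (- c) 0 a z) = q z" if z: "z \<in> hplane" for z
  proof -
    have "Im (of_real d * z - of_real c) \<noteq> 0" using d z by (simp add: hplane_def)
    then have "of_real d * z - of_real c \<noteq> (0::complex)" by (metis zero_complex.simps(2))
    moreover have "z \<noteq> 0" using nz z by blast
    ultimately have "- (1 / moeb d (- c) 0 a z) = moeb a 0 c d (- (1 / z))"
      using d by (simp add: moeb_def divide_simps)
    then show ?thesis using inv[OF J[OF z]] by (simp add: q_def)
  qed
  then have "- c = 0" using invariant_upper_triangular[OF liq k dilq det'] by blast
  then show ?thesis by simp
qed

section \<open>Relative position of two axes\<close>

lemma moeb_vert_coordinates:
  assumes "a * d - b * c = 1"
  shows "Re (moeb a b c d (vert t)) = (a * c * (exp t)\<^sup>2 + b * d) / (c\<^sup>2 * (exp t)\<^sup>2 + d\<^sup>2)"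
    and "Im (moeb a b c d (vert t)) = exp t / (c\<^sup>2 * (exp t)\<^sup>2 + d\<^sup>2)"
    and "(cmod (moeb a b c d (vert t)))\<^sup>2 = (a\<^sup>2 * (exp t)\<^sup>2 + b\<^sup>2) / (c\<^sup>2 * (exp t)\<^sup>2 + d\<^sup>2)"
    and "c\<^sup>2 * (exp t)\<^sup>2 + d\<^sup>2 > 0"
proof -
  have den: "(cmod (of_real c * vert t + of_real d))\<^sup>2 = c\<^sup>2 * (exp t)\<^sup>2 + d\<^sup>2"
    by (simp add: cmod_power2 vert_def power_mult_distrib)
  show "Im (moeb a b c d (vert t)) = exp t / (c\<^sup>2 * (exp t)\<^sup>2 + d\<^sup>2)"
    unfolding Im_moeb[OF assms] den by (simp add: vert_def)
  show "Re (moeb a b c d (vert t)) = (a * c * (exp t)\<^sup>2 + b * d) / (c\<^sup>2 * (exp t)\<^sup>2 + d\<^sup>2)"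
    unfolding moeb_def Re_divide by (simp add: vert_def power_mult_distrib power2_eq_square algebra_simps)
  show "(cmod (moeb a b c d (vert t)))\<^sup>2 = (a\<^sup>2 * (exp t)\<^sup>2 + b\<^sup>2) / (c\<^sup>2 * (exp t)\<^sup>2 + d\<^sup>2)"
    unfolding moeb_def norm_divide power_divide den by (simp add: cmod_power2 vert_def power_mult_distrib)
  show "c\<^sup>2 * (exp t)\<^sup>2 + d\<^sup>2 > 0"
    using moeb_denom[OF assms vert_hplane[of t]] by (simp flip: den)
qed

lemma imaginary_eq_vert:
  assumes "z \<in> hplane" "Re z = 0"
  shows "z = vert (ln (Im z))"
  using assms by (simp add: vert_def hplane_def complex_eq_iff)

text \<open>The endpoints \<open>a / c\<close> and \<open>b / d\<close> of the geodesic lie on different sides of \<open>0\<close>.\<close>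

lemma crosses_axis:
  assumes det: "a * d - b * c = 1" and neg: "a * b * c * d < 0"
  shows "\<exists>s t. moeb a b c d (vert t) = vert s"
proof -
  have ac: "a * c \<noteq> 0" using neg by auto
  have "- (b * d) / (a * c) = - (a * b * c * d) / (a * c)\<^sup>2" using ac by (simp add: field_simps power2_eq_square)
  also have "\<dots> > 0" using neg ac by (intro divide_pos_pos) auto
  finally have pos: "- (b * d) / (a * c) > 0" .
  define t where "t = ln (- (b * d) / (a * c)) / 2"
  have "(exp t)\<^sup>2 = - (b * d) / (a * c)" using pos by (simp add: t_def exp_double[symmetric])
  then have "a * c * (exp t)\<^sup>2 + b * d = 0" using ac by simp
  then have "Re (moeb a b c d (vert t)) = 0" by (simp add: moeb_vert_coordinates[OF det])
  then show ?thesis using imaginary_eq_vert[OF moeb_hplane[OF det vert_hplane]] by blast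
qed

text \<open>For disjoint geodesics the right-hand side is the hyperbolic cosine of their distance; the
estimate is the inequality of arithmetic and geometric means.\<close>

lemma cosh_dist_axis:
  assumes det: "a * d - b * c = 1"
  shows "cosh (hdist (moeb a b c d (vert t)) (vert s)) \<ge> \<bar>a * d + b * c\<bar>"
proof -
  define u v where "u = exp t" and "v = exp s"
  have uv: "u > 0" "v > 0" by (auto simp: u_def v_def)
  define m where "m = c\<^sup>2 * u\<^sup>2 + d\<^sup>2"
  have m: "m > 0" using moeb_vert_coordinates(4)[OF det] by (simp add: m_def u_def)
  have "cosh (hdist (moeb a b c d (vert t)) (vert s)) =
     ((a\<^sup>2 * u\<^sup>2 + b\<^sup>2) / m * (1 / v) + v) / (2 * (u / m))"
    unfolding cosh_hdist_vert[OF moeb_hplane[OF det vert_hplane]] moeb_vert_coordinates(2,3)[OF det] m_def u_def v_def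
    by (simp add: exp_minus inverse_eq_divide)
  also have "\<dots> = (a\<^sup>2 * u\<^sup>2 + b\<^sup>2 + v\<^sup>2 * m) / (2 * u * v)"
    using m uv by (simp add: field_simps power2_eq_square)
  also have "\<dots> \<ge> \<bar>a * d + b * c\<bar>"
  proof -
    have "2 * \<bar>x * y\<bar> \<le> x\<^sup>2 + y\<^sup>2" for x y :: real
      using zero_le_power2[of "\<bar>x\<bar> - \<bar>y\<bar>"] by (simp add: power2_diff abs_mult)
    from this[of "a * u" "v * d"] this[of b "v * c * u"]
    have "2 * u * v * (\<bar>a * d\<bar> + \<bar>b * c\<bar>) \<le> a\<^sup>2 * u\<^sup>2 + b\<^sup>2 + v\<^sup>2 * m"
      using uv by (simp add: abs_mult m_def power_mult_distrib algebra_simps)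
    moreover have "2 * u * v * \<bar>a * d + b * c\<bar> \<le> 2 * u * v * (\<bar>a * d\<bar> + \<bar>b * c\<bar>)"
      using uv by (intro mult_left_mono) auto
    ultimately have "2 * u * v * \<bar>a * d + b * c\<bar> \<le> a\<^sup>2 * u\<^sup>2 + b\<^sup>2 + v\<^sup>2 * m" by linarith
    moreover have "2 * u * v > 0" using uv by simp
    ultimately show ?thesis by (subst pos_le_divide_eq) (simp_all only: mult.commute)
  qed
  finally show ?thesis .
qed

text \<open>The product vanishes exactly if an endpoint of the geodesic is \<open>0\<close> or \<open>\<infinity>\<close>. Then the translation
along the geodesic is triangular, hence diagonal by invariance, and the geodesic would be the axis itself.\<close>

lemma not_asymptotic:
  assumes li: "locally_injective p" and k: "k > 1" and dil: "\<And>z. z \<in> hplane \<Longrightarrow> p (of_real k * z) = p z"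
    and det: "a * d - b * c = 1" and e: "e > 1"
    and inv: "\<And>z. z \<in> hplane \<Longrightarrow>
       p (moeb (a * d * e - b * c / e) (- (a * b * (e - 1 / e))) (c * d * (e - 1 / e)) (a * d / e - b * c * e) z) = p z"
    and disj: "range vert \<inter> range (\<lambda>t. moeb a b c d (vert t)) = {}"
  shows "a * b * c * d > 0"
proof (rule ccontr)
  assume "\<not> ?thesis"
  moreover have "\<not> a * b * c * d < 0" using crosses_axis[OF det] disj by fastforce
  ultimately have zero: "a * b = 0 \<or> c * d = 0" by auto
  have det2: "(a * d * e - b * c / e) * (a * d / e - b * c * e) - (- (a * b * (e - 1 / e))) * (c * d * (e - 1 / e)) = 1"
    using moeb_translation(1)[OF det] e by simp
  have ne: "e - 1 / e \<noteq> 0"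
  proof -
    have "1 / e < 1" using e by simp
    then show ?thesis using e by linarith
  qed
  have both: "a * b = 0" "c * d = 0"
  proof -
    have "c * d * (e - 1 / e) = 0" if "a * b = 0"
    proof (rule invariant_lower_triangular[OF li k dil])
      show "(a * d * e - b * c / e) * (a * d / e - b * c * e) = 1" using det2 that by simp
      show "p (moeb (a * d * e - b * c / e) 0 (c * d * (e - 1 / e)) (a * d / e - b * c * e) z) = p z"
        if "z \<in> hplane" for z using inv[OF that] \<open>a * b = 0\<close> by simp
    qed
    moreover have "- (a * b * (e - 1 / e)) = 0" if "c * d = 0"
    proof (rule invariant_upper_triangular[OF li k dil])
      show "(a * d * e - b * c / e) * (a * d / e - b * c * e) = 1" using det2 that by simp
      show "p (moeb (a * d * e - b * c / e) (- (a * b * (e - 1 / e))) 0 (a * d / e - b * c * e) z) = p z"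
        if "z \<in> hplane" for z using inv[OF that] \<open>c * d = 0\<close> by simp
    qed
    ultimately show "a * b = 0" "c * d = 0" using zero ne by auto
  qed
  then have "Re (moeb a b c d (vert 0)) = 0"
    unfolding moeb_vert_coordinates[OF det] using det by auto
  then have "moeb a b c d (vert 0) = vert (ln (Im (moeb a b c d (vert 0))))"
    using imaginary_eq_vert moeb_hplane[OF det] by simp
  then show False using disj by blast
qed

text \<open>If \<open>b * c > 0\<close> both geodesics have the same direction, and if \<open>b * c < - 1\<close> opposite directions. The
translation along the axis is inverted in the first case only, so that the trace of the product
with the other translation is \<open>2 - (\<bar>a * d + b * c\<bar> - 1) * (e - 1 / e)\<^sup>2 / 2\<close> in both cases.\<close>

lemma equal_length_axes_far_apart:
  assumes li: "locally_injective p" and e: "e > 1"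
    and dil: "\<And>z. z \<in> hplane \<Longrightarrow> p (of_real (e\<^sup>2) * z) = p z"
    and det: "a * d - b * c = 1"
    and inv: "\<And>z. z \<in> hplane \<Longrightarrow>
       p (moeb (a * d * e - b * c / e) (- (a * b * (e - 1 / e))) (c * d * (e - 1 / e)) (a * d / e - b * c * e) z) = p z"
    and disj: "range vert \<inter> range (\<lambda>t. moeb a b c d (vert t)) = {}"
  shows "(\<bar>a * d + b * c\<bar> - 1) * (e - 1 / e)\<^sup>2 \<ge> 8"
proof -
  define i where "i = 1 / e"
  have i: "e * i = 1" "x / e = x * i" "i > 0" for x using e by (auto simp: i_def)
  have k: "e\<^sup>2 > 1" using e by simp
  have pos: "a * b * c * d > 0" using not_asymptotic[OF li k dil det e inv disj] .
  let ?A = "a * d * e - b * c / e" and ?B = "- (a * b * (e - 1 / e))" and ?C = "c * d * (e - 1 / e)" and ?D = "a * d / e - b * c * e"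
  have det2: "?A * ?D - ?B * ?C = 1" using moeb_translation(1)[OF det] e by simp
  have tr: "\<bar>f * ?A + g * ?D\<bar> \<ge> 2" if fg: "f * g = 1" "f > 0" "g > 0" and f: "f = e \<or> g = e" for f g
  proof (rule invariant_trace[OF li])
    show "f * ?A * (g * ?D) - f * ?B * (g * ?C) = 1"
    proof -
      have "f * A * (g * D) - f * B * (g * C) = (f * g) * (A * D - B * C)" for A B C D
        by (simp add: algebra_simps)
      then show ?thesis by (simp only: det2 fg(1) mult_1)
    qed
    fix z assume z: "z \<in> hplane"
    define w where "w = moeb ?A ?B ?C ?D z"
    have w: "w \<in> hplane" unfolding w_def using moeb_hplane[OF det2 z] .
    have "f * g - 0 * 0 = 1" using fg by simp
    have "moeb (f * ?A) (f * ?B) (g * ?C) (g * ?D) z = moeb f 0 0 g w"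
      unfolding w_def moeb_moeb[OF det2 z] by simp
    also have "\<dots> = of_real (f / g) * w" using fg by (simp add: moeb_def)
    finally have eq: "moeb (f * ?A) (f * ?B) (g * ?C) (g * ?D) z = of_real (f / g) * w" .
    have "p (of_real (f / g) * w) = p w"
      using f
    proof
      assume "f = e"
      then have "f / g = e\<^sup>2" using fg by (simp add: field_simps power2_eq_square)
      then show ?thesis using dil[OF w] by simp
    next
      assume "g = e"
      then have *: "e\<^sup>2 * (f / g) = 1" using fg by (simp add: field_simps power2_eq_square)
      have "of_real (f / g) * w \<in> hplane" using fg w by (intro of_real_mult_hplane) auto
      then have "p (of_real (e\<^sup>2) * (of_real (f / g) * w)) = p (of_real (f / g) * w)" by (rule dil)
      moreover have "of_real (e\<^sup>2) * (of_real (f / g) * w) = w"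
        by (metis * mult.assoc mult_1 of_real_1 of_real_mult)
      ultimately show ?thesis by simp
    qed
    also have "p w = p z" unfolding w_def by (rule inv[OF z])
    finally show "p (moeb (f * ?A) (f * ?B) (g * ?C) (g * ?D) z) = p z" using eq by simp
  qed
  define y where "y = (e - i)\<^sup>2"
  have "i < 1" using e by (simp add: i_def)
  then have y: "y > 0" using e by (simp add: y_def)
  show ?thesis
  proof (cases "b * c > 0")
    case True
    have eq: "i * ?A + e * ?D = 2 - b * c * y"
    proof -
      have "i * ?A + e * ?D = 2 * (a * d - b * c) * (e * i) - b * c * y"
        unfolding i(2) y_def by (simp add: power2_eq_square algebra_simps)
      then show ?thesis by (simp only: i(1) det)
    qed
    moreover have "b * c * y > 0" using True y by simp
    moreover have "\<bar>i * ?A + e * ?D\<bar> \<ge> 2" by (rule tr) (use i e in \<open>auto simp: mult.commute\<close>)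
    ultimately have "b * c * y \<ge> 4" unfolding eq by linarith
    moreover have "\<bar>a * d + b * c\<bar> - 1 = 2 * (b * c)" using True det by auto
    ultimately show ?thesis by (simp add: y_def i_def)
  next
    case False
    have "(a * d) * (b * c) > 0" using pos by (simp add: mult_ac)
    then have ad: "a * d < 0" "b * c < 0" using False by (auto simp: zero_less_mult_iff)
    have eq: "e * ?A + i * ?D = 2 + a * d * y"
    proof -
      have "e * ?A + i * ?D = 2 * (a * d - b * c) * (e * i) + a * d * y"
        unfolding i(2) y_def by (simp add: power2_eq_square algebra_simps)
      then show ?thesis by (simp only: i(1) det)
    qed
    moreover have "a * d * y < 0" using ad(1) y by (rule mult_neg_pos)
    moreover have "\<bar>e * ?A + i * ?D\<bar> \<ge> 2" by (rule tr) (use i e in auto)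
    ultimately have "- (a * d * y) \<ge> 4" unfolding eq by linarith
    moreover have "\<bar>a * d + b * c\<bar> - 1 = - (2 * (a * d))" using ad det by auto
    ultimately show ?thesis by (simp add: y_def i_def)
  qed
qed

text \<open>Let \<open>M\<close> be the matrix of \<open>a, b, c, d\<close>. The dilation by \<open>e\<^sup>2\<close> is the translation \<open>T\<close> along the axis, and
in the coordinates given by \<open>M\<close> the translate of the geodesic is the image of the axis under \<open>M\<^sup>-\<^sup>1 T M\<close>, whose entries are
\<open>?A, ?B, ?C, ?D\<close>. The translate does not cross the geodesic, and the sign criterion for crossing
turns into \<open>?B * ?C \<le> - 1\<close>.\<close>

lemma disjoint_translates_far_from_axis:
  assumes det: "a * d - b * c = 1" and pos: "a * b * c * d > 0" and e: "e > 1"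
    and simple: "range (\<lambda>t. of_real (e\<^sup>2) * moeb a b c d (vert t)) = range (\<lambda>t. moeb a b c d (vert t)) \<or>
      range (\<lambda>t. of_real (e\<^sup>2) * moeb a b c d (vert t)) \<inter> range (\<lambda>t. moeb a b c d (vert t)) = {}"
  shows "((a * d + b * c)\<^sup>2 - 1) * (e - 1 / e)\<^sup>2 \<ge> 4"
proof -
  define i where "i = 1 / e"
  have i: "e * i = 1" "i > 0" "e - i > 0" using e by (auto simp: i_def field_simps) (metis less_1_mult)
  let ?A = "a * d * e - b * c * i" and ?B = "b * d * (e - i)" and ?C = "- (a * c * (e - i))" and ?D = "a * d * i - b * c * e"
  have "?A * ?D - ?B * ?C = (a * d - b * c)\<^sup>2 * (e * i)"
    by (simp add: power2_eq_square algebra_simps)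
  then have det2: "?A * ?D - ?B * ?C = 1" by (simp only: i(1) det) simp
  have det': "d * a - (- b) * (- c) = 1" and deti: "e * i - 0 * 0 = 1" using det i by (auto simp: mult.commute)
  have scale: "of_real (e\<^sup>2) * z = moeb e 0 0 i z" for z
    using e by (simp add: moeb_def i_def power2_eq_square)
  have N: "moeb d (- b) (- c) a (of_real (e\<^sup>2) * moeb a b c d z) = moeb ?A ?B ?C ?D z" if z: "z \<in> hplane" for z
  proof -
    have "moeb d (- b) (- c) a (of_real (e\<^sup>2) * moeb a b c d z) =
        moeb (d * e) (- b * i) (- c * e) (a * i) (moeb a b c d z)"
      unfolding scale using moeb_moeb[OF deti moeb_hplane[OF det z], of d "-b" "-c" a] by simp
    also have "\<dots> = moeb ?A ?B ?C ?D z"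
      unfolding moeb_moeb[OF det z] by (simp add: algebra_simps)
    finally show ?thesis .
  qed
  have BC: "?B * ?C < 0" "?B \<noteq> 0" "?C \<noteq> 0"
  proof -
    have "?B * ?C = - (a * b * c * d * (e - i)\<^sup>2)" by (simp add: power2_eq_square algebra_simps)
    moreover have "a * b * c * d * (e - i)\<^sup>2 > 0" using i by (intro mult_pos_pos[OF pos]) auto
    ultimately show "?B * ?C < 0" by linarith
    then show "?B \<noteq> 0" "?C \<noteq> 0" by auto
  qed
  have not_eq: "range (\<lambda>t. of_real (e\<^sup>2) * moeb a b c d (vert t)) \<noteq> range (\<lambda>t. moeb a b c d (vert t))"
  proof
    assume eq: "range (\<lambda>t. of_real (e\<^sup>2) * moeb a b c d (vert t)) = range (\<lambda>t. moeb a b c d (vert t))"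
    have ax: "?A * ?C * (exp t)\<^sup>2 + ?B * ?D = 0" for t
    proof -
      obtain s where "of_real (e\<^sup>2) * moeb a b c d (vert t) = moeb a b c d (vert s)"
        using eq by (metis (no_types, lifting) rangeE rangeI)
      then have "moeb ?A ?B ?C ?D (vert t) = vert s"
        using N[of "vert t"] moeb_inv1[OF det, of "vert s"] by simp
      then have "Re (moeb ?A ?B ?C ?D (vert t)) = 0" by (simp add: vert_def)
      then show ?thesis using moeb_vert_coordinates(1,4)[OF det2, of t] by (simp only: divide_eq_0_iff) auto
    qed
    have "?A * ?C * ((exp 1)\<^sup>2 - 1) = 0" using ax[of 0] ax[of 1] by (simp add: algebra_simps)
    moreover have "1 < (exp (1::real))\<^sup>2" by (rule one_less_power) auto
    ultimately have "?A = 0" using BC by simp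
    then have "?D = 0" using ax[of 0] BC by simp
    then have "?A + ?D = 0" using \<open>?A = 0\<close> by simp
    moreover have "?A + ?D = (a * d - b * c) * (e + i)" by (simp add: algebra_simps)
    ultimately show False using det i e by simp
  qed
  have "\<not> ?A * ?B * ?C * ?D < 0"
  proof
    assume "?A * ?B * ?C * ?D < 0"
    then obtain s t where "moeb ?A ?B ?C ?D (vert t) = vert s" using crosses_axis[OF det2] by blast
    then have "moeb d (- b) (- c) a (of_real (e\<^sup>2) * moeb a b c d (vert t)) = vert s" using N by simp
    moreover have "of_real (e\<^sup>2) * moeb a b c d (vert t) \<in> hplane"
      using moeb_hplane[OF det] e by (intro of_real_mult_hplane) auto
    ultimately have "of_real (e\<^sup>2) * moeb a b c d (vert t) = moeb a b c d (vert s)"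
      using moeb_inv2[OF det] by metis
    then show False using simple not_eq by (metis (no_types, lifting) disjoint_iff rangeI)
  qed
  then have "(?B * ?C) * (?A * ?D) \<ge> 0" by (simp add: mult_ac)
  then have "?A * ?D \<le> 0" using BC(1) by (metis mult_neg_pos not_less)
  then have "- (?B * ?C) \<ge> 1" using det2 by linarith
  also have "- (?B * ?C) = a * b * c * d * (e - i)\<^sup>2"
    by (simp add: power2_eq_square algebra_simps)
  finally have "4 * (a * b * c * d) * (e - i)\<^sup>2 \<ge> 4" by simp
  also have "4 * (a * b * c * d) = (a * d + b * c)\<^sup>2 - (a * d - b * c)\<^sup>2"
    by (simp add: power2_eq_square algebra_simps)
  finally show ?thesis unfolding i_def[symmetric] by (simp add: det)
qed

section \<open>Stable neighbourhoods\<close>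

text \<open>These are \<open>cosh r = coth (l / 2)\<close> and \<open>sinh r = 1 / sinh (l / 2)\<close> for the width \<open>r\<close>, the latter
in terms of the doubled width, which is what the distance of two lifts is compared with.\<close>

lemma collar_width_identities:
  assumes "l > 0"
  shows "collar_width (l / 2) > 0" "sinh (l / 2) * cosh (collar_width (l / 2)) = cosh (l / 2)"
    "(sinh (l / 2))\<^sup>2 * (cosh (2 * collar_width (l / 2)) - 1) = 2"
proof -
  define x where "x = l / 4"
  have x: "l / 2 = 2 * x" "l / 2 / 2 = x" "x > 0" "sinh x > 0" "cosh x > 0" using assms by (auto simp: x_def)
  have ex: "exp (collar_width (l / 2)) = cosh x / sinh x"
    unfolding collar_width_def x(2) using x by simp
  have "cosh x / sinh x > 1" using x sinh_less_cosh_real[of x] by simp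
  then show "collar_width (l / 2) > 0" unfolding collar_width_def x(2) by (simp add: ln_gt_zero)
  have c: "cosh (collar_width (l / 2)) = (cosh x / sinh x + sinh x / cosh x) / 2"
    unfolding cosh_def[of "collar_width (l / 2)"] exp_minus ex by (simp add: scaleR_conv_of_real)
  then have c2: "cosh (collar_width (l / 2)) = ((cosh x)\<^sup>2 + (sinh x)\<^sup>2) / (2 * sinh x * cosh x)"
    using x by (simp add: field_simps power2_eq_square)
  then show 1: "sinh (l / 2) * cosh (collar_width (l / 2)) = cosh (l / 2)"
    unfolding x(1) sinh_double cosh_double using x by (simp add: field_simps)
  have "(sinh (l / 2))\<^sup>2 * (cosh (2 * collar_width (l / 2)) - 1) =
      2 * (sinh (l / 2) * cosh (collar_width (l / 2)))\<^sup>2 - 2 * (sinh (l / 2))\<^sup>2"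
    by (simp add: cosh_double_cosh power_mult_distrib algebra_simps)
  also have "\<dots> = 2" unfolding 1 by (simp add: cosh_square_eq)
  finally show "(sinh (l / 2))\<^sup>2 * (cosh (2 * collar_width (l / 2)) - 1) = 2" .
qed

lemma exp_half_diff: "exp (l / 2) - 1 / exp (l / 2) = 2 * sinh (l / 2 :: real)"
  by (simp add: sinh_def exp_minus inverse_eq_divide)

lemma closed_geodesic_stable:
  assumes uc: "universal_cover S \<pi>" and ori: "orientable_surface S" and \<omega>: "closed_geodesic S \<omega> l"
  shows "stable_nbhd \<pi> \<omega> (collar_width (l / 2))"
  unfolding stable_nbhd_def
proof (intro allI impI)
  fix L1 L2 assume "connected_lift \<pi> \<omega> L1 \<and> connected_lift \<pi> \<omega> L2"
  then obtain h1 h2 where h1: "continuous_on UNIV h1" "range h1 \<subseteq> hplane" "\<And>t. \<pi> (h1 t) = \<omega> t" "L1 = range h1"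
    and h2: "continuous_on UNIV h2" "range h2 \<subseteq> hplane" "\<And>t. \<pi> (h2 t) = \<omega> t" "L2 = range h2"
    unfolding connected_lift_def by blast
  have l: "l > 0" using \<omega> by (simp add: closed_geodesic_def)
  define r where "r = collar_width (l / 2)"
  have r: "r > 0" using collar_width_identities(1)[OF l] by (simp add: r_def)
  show "L1 \<inter> L2 \<noteq> {} \<longleftrightarrow> nbhd hplane hdist (collar_width (l / 2)) L1 \<inter> nbhd hplane hdist (collar_width (l / 2)) L2 \<noteq> {}"
    unfolding r_def[symmetric]
  proof
    assume "L1 \<inter> L2 \<noteq> {}"
    then obtain z where z: "z \<in> L1" "z \<in> L2" by blast
    then have "z \<in> hplane" using h1 by blast
    moreover then have "hdist z z < r" using r by (simp add: hdist_self)
    ultimately have "z \<in> nbhd hplane hdist r L1 \<inter> nbhd hplane hdist r L2"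
      unfolding nbhd_def using z by blast
    then show "nbhd hplane hdist r L1 \<inter> nbhd hplane hdist r L2 \<noteq> {}" by blast
  next
    assume "nbhd hplane hdist r L1 \<inter> nbhd hplane hdist r L2 \<noteq> {}"
    then obtain z s t where z: "z \<in> hplane" "hdist z (h1 s) < r" "hdist z (h2 t) < r"
      unfolding nbhd_def h1(4) h2(4) by blast
    show "L1 \<inter> L2 \<noteq> {}"
    proof
      assume disj: "L1 \<inter> L2 = {}"
      obtain a b c d where M: "a * d - b * c = 1" "\<And>t. h1 t = moeb a b c d (vert t)"
        using lift_of_closed_geodesic[OF uc \<omega> h1(1-3)] by metis
      obtain a' b' c' d' where M': "a' * d' - b' * c' = 1" "\<And>t. h2 t = moeb a' b' c' d' (vert t)"
        using lift_of_closed_geodesic[OF uc \<omega> h2(1-3)] by metis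
      obtain A B C D where N: "A * D - B * C = 1"
        "\<And>z. z \<in> hplane \<Longrightarrow> moeb a b c d (moeb A B C D z) = moeb a' b' c' d' z"
        using relative_moeb[OF M(1) M'(1)] by metis
      define p where "p z = \<pi> (moeb a b c d z)" for z
      define e where "e = exp (l / 2)"
      have e: "e > 1" using l by (simp add: e_def)
      have e0: "e > 0" using e by simp
      have li: "locally_injective p" unfolding p_def by (rule universal_cover_locally_injective[OF uc M(1)])
      have dil: "p (of_real (e\<^sup>2) * z) = p z" if "z \<in> hplane" for z
        unfolding p_def e_def
        by (rule closed_geodesic_deck_transformation[OF uc ori \<omega> M(1) _ that]) (use h1(3) M(2) in simp)
      have dil': "p (moeb A B C D (of_real (e\<^sup>2) * w)) = p (moeb A B C D w)" if w: "w \<in> hplane" for w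
      proof -
        have ew: "of_real (e\<^sup>2) * w \<in> hplane" using e w by (intro of_real_mult_hplane) auto
        have "\<pi> (moeb a' b' c' d' (of_real ((exp (l / 2))\<^sup>2) * w)) = \<pi> (moeb a' b' c' d' w)"
          by (rule closed_geodesic_deck_transformation[OF uc ori \<omega> M'(1) _ w]) (use h2(3) M'(2) in simp)
        then show ?thesis unfolding p_def N(2)[OF ew] N(2)[OF w] by (simp only: e_def)
      qed
      have disj': "range vert \<inter> range (\<lambda>t. moeb A B C D (vert t)) = {}"
      proof (rule ccontr)
        assume "\<not> ?thesis"
        then obtain u v where "vert u = moeb A B C D (vert v)" by blast
        then have "h1 u = h2 v" using M(2) M'(2) N(2)[OF vert_hplane] by metis
        then show False using disj h1(4) h2(4) by blast
      qed
      note inv = relative_translation_invariant[where p = p, OF N(1) e0 dil']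
      have far: "(\<bar>A * D + B * C\<bar> - 1) * (e - 1 / e)\<^sup>2 \<ge> 8"
        using equal_length_axes_far_apart[OF li e dil N(1) inv disj'] by blast
      have hh: "h1 s \<in> hplane" "h2 t \<in> hplane" using h1 h2 by auto
      have "hdist (h1 s) (h2 t) < 2 * r"
        using hdist_triangle[OF hh z(1)] z(2,3) by (simp add: hdist_commute)
      moreover have "hdist (h1 s) (h2 t) = hdist (moeb A B C D (vert t)) (vert s)"
      proof -
        have "hdist (h1 s) (h2 t) = hdist (moeb a b c d (vert s)) (moeb a b c d (moeb A B C D (vert t)))"
          using M(2) M'(2) N(2)[OF vert_hplane] by simp
        also have "\<dots> = hdist (vert s) (moeb A B C D (vert t))"
          using hdist_moeb[OF M(1)] moeb_hplane[OF N(1)] by simp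
        finally show ?thesis by (simp add: hdist_commute)
      qed
      ultimately have "cosh (hdist (moeb A B C D (vert t)) (vert s)) < cosh (2 * r)"
        using cosh_real_nonneg_less_iff[of "hdist (h1 s) (h2 t)" "2 * r"] hdist_nonneg[OF hh] r by simp
      then have "\<bar>A * D + B * C\<bar> - 1 < cosh (2 * r) - 1" using cosh_dist_axis[OF N(1), of t s] by linarith
      moreover have sh: "(sinh (l / 2))\<^sup>2 > 0" using l by simp
      ultimately have "(sinh (l / 2))\<^sup>2 * (\<bar>A * D + B * C\<bar> - 1) < (sinh (l / 2))\<^sup>2 * (cosh (2 * r) - 1)"
        by (rule mult_strict_left_mono)
      also have "\<dots> = 2" using collar_width_identities(3)[OF l] by (simp add: r_def)
      finally show False
        using far unfolding e_def exp_half_diff by (simp add: power_mult_distrib mult.commute)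
    qed
  qed
qed

lemma closed_geodesic_periodic:
  assumes "closed_geodesic S \<gamma> l"
  shows "\<gamma> (t + of_int n * l) = \<gamma> t"
proof (induction n rule: int_induct[where k = 0])
  case (step1 i)
  have "\<gamma> (t + of_int i * l + l) = \<gamma> (t + of_int i * l)" using assms by (simp add: closed_geodesic_def)
  then show ?case using step1 by (simp add: algebra_simps)
next
  case (step2 i)
  have "\<gamma> (t + of_int (i - 1) * l + l) = \<gamma> (t + of_int (i - 1) * l)" using assms by (simp add: closed_geodesic_def)
  then show ?case using step2 by (simp add: algebra_simps)
qed simp

text \<open>Lifts that meet pass through the meeting point at times that differ by a multiple of the period,
because \<open>\<gamma>\<close> is simple. After a shift of time they are lifts of the same curve with a common point.\<close>

lemma lifts_of_simple_geodesic_disjoint: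
  assumes uc: "universal_cover S \<pi>" and \<gamma>: "simple_closed_geodesic S \<gamma> l"
    and k: "continuous_on UNIV k" "range k \<subseteq> hplane" "\<And>t. \<pi> (k t) = \<gamma> t"
    and k': "continuous_on UNIV k'" "range k' \<subseteq> hplane" "\<And>t. \<pi> (k' t) = \<gamma> t"
  shows "range k = range k' \<or> range k \<inter> range k' = {}"
proof (rule disjCI)
  assume "range k \<inter> range k' \<noteq> {}"
  then obtain s t where st: "k s = k' t" by blast
  have cg: "closed_geodesic S \<gamma> l" and inj: "inj_on \<gamma> {0..<l}" and l: "l > 0"
    using \<gamma> by (auto simp: simple_closed_geodesic_def closed_geodesic_def)
  define n where "n x = \<lfloor>x / l\<rfloor>" for x :: real
  have red: "x - of_int (n x) * l \<in> {0..<l}" for x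
  proof -
    have "of_int (n x) \<le> x / l" "x / l < of_int (n x) + 1" unfolding n_def by linarith+
    then show ?thesis using l by (auto simp: field_simps)
  qed
  have per: "\<gamma> (x - of_int m * l) = \<gamma> x" for x m
    using closed_geodesic_periodic[OF cg, of x "- m"] by simp
  have "\<gamma> (s - of_int (n s) * l) = \<gamma> (t - of_int (n t) * l)"
    unfolding per using k(3)[of s] k'(3)[of t] st by simp
  then have "s - of_int (n s) * l = t - of_int (n t) * l" using inj_onD[OF inj _ red red] by blast
  then have t: "t = s - of_int (n s - n t) * l" by (simp add: algebra_simps)
  have eq: "k (s + u) = k' (t + u)" for u
  proof (rule covering_space_lift_unique[of hplane \<pi> S "\<lambda>u. k (s + u)" 0 "\<lambda>u. k' (t + u)" UNIV "\<lambda>u. \<gamma> (s + u)"])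
    show "covering_space hplane \<pi> S" using uc by (simp add: universal_cover_def)
    show "continuous_on UNIV (\<lambda>u. \<gamma> (s + u))"
      by (rule continuous_on_compose2[OF closed_geodesic_continuous[OF cg]]) (auto intro: continuous_intros)
    show "continuous_on UNIV (\<lambda>u. k (s + u))"
      by (rule continuous_on_compose2[OF k(1)]) (auto intro: continuous_intros)
    show "continuous_on UNIV (\<lambda>u. k' (t + u))"
      by (rule continuous_on_compose2[OF k'(1)]) (auto intro: continuous_intros)
    show "\<gamma> (s + u) = \<pi> (k' (t + u))" for u
    proof -
      have "t + u = s + u - of_int (n s - n t) * l" using t by simp
      then have "\<gamma> (t + u) = \<gamma> (s + u)" using per by metis
      then show ?thesis by (simp add: k'(3))
    qed
    show "(\<lambda>u. \<gamma> (s + u)) \<in> UNIV \<rightarrow> S" using cg by (auto simp: closed_geodesic_def)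
  qed (use st k k' in auto)
  have "k x \<in> range k'" for x using eq[of "x - s"] by auto
  moreover have "k' x \<in> range k" for x using eq[of "x - t"] by (metis add_diff_cancel_left' diff_add_cancel add.commute rangeI)
  ultimately show "range k = range k'" by blast
qed

text \<open>The path and both geodesics are lifted to \<open>G\<close>, \<open>h\<close> and \<open>k\<close>, and \<open>h\<close> is moved to the axis. The
translate \<open>k'\<close> of \<open>k\<close> along \<open>h\<close> is another lift of \<open>\<gamma>\<close>.\<close>

lemma short_path_avoids_simple_geodesic:
  assumes uc: "universal_cover S \<pi>" and ori: "orientable_surface S"
    and \<omega>: "closed_geodesic S \<omega> l" and \<gamma>: "simple_closed_geodesic S \<gamma> m"
    and disj: "range \<omega> \<inter> range \<gamma> = {}"
    and g: "path g" "path_image g \<subseteq> S" "pathstart g \<in> range \<omega>"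
    and short: "curve_length g < ereal (collar_width (l / 2))"
  shows "path_image g \<inter> range \<gamma> = {}"
proof (rule ccontr)
  assume "\<not> ?thesis"
  then obtain q where "q \<in> path_image g" "q \<in> range \<gamma>" by blast
  then obtain \<tau> \<sigma> where \<tau>: "\<tau> \<in> {0..1}" "g \<tau> = \<gamma> \<sigma>" unfolding path_image_def by (metis imageE)
  have l: "l > 0" using \<omega> by (simp add: closed_geodesic_def)
  have cg: "closed_geodesic S \<gamma> m" and m: "m > 0" using \<gamma> by (auto simp: simple_closed_geodesic_def closed_geodesic_def)
  note cov = universal_cover_simps[OF uc]
  obtain t0 where t0: "g 0 = \<omega> t0" using g(3) by (auto simp: pathstart_def)
  have \<omega>S: "range \<omega> \<subseteq> S" and \<gamma>S: "range \<gamma> \<subseteq> S" using \<omega> cg by (auto simp: closed_geodesic_def)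
  then obtain x where x: "x \<in> hplane" "\<pi> x = \<omega> t0" using cov(3) by (metis imageE range_subsetD)
  obtain G where G: "continuous_on {0..1} G" "G ` {0..1} \<subseteq> hplane" "G 0 = x" "\<And>t. t \<in> {0..1} \<Longrightarrow> \<pi> (G t) = g t"
    using covering_space_lift_interval[OF cov(1), of 0 1 g 0 x] g(1,2) x t0
    by (auto simp: path_def path_image_def)
  have G\<tau>: "G \<tau> \<in> hplane" "\<pi> (G \<tau>) = \<gamma> \<sigma>" using G \<tau> by auto
  obtain h where h: "continuous_on UNIV h" "range h \<subseteq> hplane" "h t0 = x" "\<And>t. \<pi> (h t) = \<omega> t"
    using covering_space_lift_real_line[OF cov(1) closed_geodesic_continuous[OF \<omega>] \<omega>S x] by metis
  obtain k where k: "continuous_on UNIV k" "range k \<subseteq> hplane" "k \<sigma> = G \<tau>" "\<And>t. \<pi> (k t) = \<gamma> t"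
    using covering_space_lift_real_line[OF cov(1) closed_geodesic_continuous[OF cg] \<gamma>S G\<tau>] by metis
  obtain a b c d where M: "a * d - b * c = 1" "\<And>t. h t = moeb a b c d (vert t)"
    using lift_of_closed_geodesic[OF uc \<omega> h(1,2,4)] by metis
  obtain a' b' c' d' where M': "a' * d' - b' * c' = 1" "\<And>t. k t = moeb a' b' c' d' (vert t)"
    using lift_of_closed_geodesic[OF uc cg k(1,2,4)] by metis
  obtain A B C D where N: "A * D - B * C = 1"
    "\<And>z. z \<in> hplane \<Longrightarrow> moeb a b c d (moeb A B C D z) = moeb a' b' c' d' z"
    using relative_moeb[OF M(1) M'(1)] by metis
  have kN: "k t = moeb a b c d (moeb A B C D (vert t))" for t using M'(2) N(2)[OF vert_hplane] by simp
  define p where "p z = \<pi> (moeb a b c d z)" for z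
  define e f where "e = exp (l / 2)" and "f = exp (m / 2)"
  have e: "e > 1" "e\<^sup>2 > 1" and f: "f > 1" "f > 0" using l m by (auto simp: e_def f_def intro: one_less_power)
  have li: "locally_injective p" unfolding p_def by (rule universal_cover_locally_injective[OF uc M(1)])
  have dil: "p (of_real (e\<^sup>2) * z) = p z" if "z \<in> hplane" for z
    unfolding p_def e_def
    by (rule closed_geodesic_deck_transformation[OF uc ori \<omega> M(1) _ that]) (use h(4) M(2) in simp)
  have dil': "p (moeb A B C D (of_real (f\<^sup>2) * w)) = p (moeb A B C D w)" if w: "w \<in> hplane" for w
  proof -
    have fw: "of_real (f\<^sup>2) * w \<in> hplane" using f w by (intro of_real_mult_hplane) auto
    have "\<pi> (moeb a' b' c' d' (of_real ((exp (m / 2))\<^sup>2) * w)) = \<pi> (moeb a' b' c' d' w)"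
      by (rule closed_geodesic_deck_transformation[OF uc ori cg M'(1) _ w]) (use k(4) M'(2) in simp)
    then show ?thesis unfolding p_def N(2)[OF fw] N(2)[OF w] by (simp only: f_def)
  qed
  have disj': "range vert \<inter> range (\<lambda>t. moeb A B C D (vert t)) = {}"
  proof (rule ccontr)
    assume "\<not> ?thesis"
    then obtain u v where "vert u = moeb A B C D (vert v)" by blast
    then have "h u = k v" using M(2) kN by metis
    then have "\<omega> u = \<gamma> v" using h(4) k(4) by metis
    then show False using disj by blast
  qed
  note inv = relative_translation_invariant[where p = p, OF N(1) f(2) dil']
  have pos: "A * B * C * D > 0"
    using not_asymptotic[OF li e(2) dil N(1) f(1) inv disj'] by blast
  define k' where "k' t = moeb a b c d (of_real (e\<^sup>2) * moeb A B C D (vert t))" for t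
  have inH: "of_real (e\<^sup>2) * moeb A B C D (vert t) \<in> hplane" for t
    using moeb_hplane[OF N(1)] e by (intro of_real_mult_hplane) auto
  have alt: "range k' = range k \<or> range k' \<inter> range k = {}"
  proof (rule lifts_of_simple_geodesic_disjoint[OF uc \<gamma> _ _ _ k(1,2,4)])
    have "continuous_on UNIV (\<lambda>t. moeb A B C D (vert t))"
      by (rule continuous_on_compose2[OF moeb_continuous[OF N(1)] vert_continuous]) auto
    then show "continuous_on UNIV k'"
      unfolding k'_def using inH
      by (intro continuous_on_compose2[OF moeb_continuous[OF M(1)]] continuous_intros) auto
    show "range k' \<subseteq> hplane" unfolding k'_def using moeb_hplane[OF M(1) inH] by blast
    show "\<pi> (k' t) = \<gamma> t" for t
      using dil[OF moeb_hplane[OF N(1) vert_hplane]] k(4)[of t] kN[of t] by (simp add: k'_def p_def)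
  qed
  define X Y where "X = range (\<lambda>t. of_real (e\<^sup>2) * moeb A B C D (vert t))"
    and "Y = range (\<lambda>t. moeb A B C D (vert t))"
  have im: "range k' = moeb a b c d ` X" "range k = moeb a b c d ` Y"
    unfolding k'_def kN X_def Y_def by (simp_all add: image_image)
  have inj: "inj_on (moeb a b c d) hplane" using moeb_inv1[OF M(1)] by (metis inj_onI)
  have XY: "X \<subseteq> hplane" "Y \<subseteq> hplane" unfolding X_def Y_def using inH moeb_hplane[OF N(1)] by auto
  have "X = Y \<or> X \<inter> Y = {}"
    using alt unfolding im inj_on_image_eq_iff[OF inj XY] by blast
  then have simple: "range (\<lambda>t. of_real (e\<^sup>2) * moeb A B C D (vert t)) = range (\<lambda>t. moeb A B C D (vert t)) \<or>
      range (\<lambda>t. of_real (e\<^sup>2) * moeb A B C D (vert t)) \<inter> range (\<lambda>t. moeb A B C D (vert t)) = {}"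
    unfolding X_def Y_def .
  have far: "((A * D + B * C)\<^sup>2 - 1) * (e - 1 / e)\<^sup>2 \<ge> 4"
    by (rule disjoint_translates_far_from_axis[OF N(1) pos e(1) simple])
  have "ereal (hdist (G 0) (G \<tau>)) \<le> curve_length g"
    using \<tau>(1) by (intro hdist_le_curve_length[OF uc G(1,2,4)]) auto
  then have "hdist (G 0) (G \<tau>) < collar_width (l / 2)" using short
    by (meson ereal_less(2) ereal_less_eq(3) less_ereal.simps(1) order.strict_trans1)
  moreover have "hdist (G 0) (G \<tau>) = hdist (moeb A B C D (vert \<sigma>)) (vert t0)"
  proof -
    have "hdist (G 0) (G \<tau>) = hdist (moeb a b c d (vert t0)) (moeb a b c d (moeb A B C D (vert \<sigma>)))"
      using G(3) h(3) k(3) M(2) kN by simp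
    then show ?thesis using hdist_moeb[OF M(1)] moeb_hplane[OF N(1)] by (simp add: hdist_commute)
  qed
  ultimately have "cosh (hdist (moeb A B C D (vert \<sigma>)) (vert t0)) < cosh (collar_width (l / 2))"
    using collar_width_identities(1)[OF l] hdist_nonneg[OF moeb_hplane[OF N(1) vert_hplane] vert_hplane]
      cosh_real_nonneg_less_iff by simp
  then have "\<bar>A * D + B * C\<bar> < cosh (collar_width (l / 2))" using cosh_dist_axis[OF N(1), of \<sigma> t0] by linarith
  then have "(A * D + B * C)\<^sup>2 < (cosh (collar_width (l / 2)))\<^sup>2"
    by (metis abs_ge_zero power2_abs power_strict_mono zero_less_numeral)
  moreover have sh: "(sinh (l / 2))\<^sup>2 > 0" using l by simp
  ultimately have "(sinh (l / 2))\<^sup>2 * (A * D + B * C)\<^sup>2 < (sinh (l / 2))\<^sup>2 * (cosh (collar_width (l / 2)))\<^sup>2"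
    by (rule mult_strict_left_mono)
  also have "\<dots> = (sinh (l / 2))\<^sup>2 + 1"
    using collar_width_identities(2)[OF l] by (metis cosh_square_eq power_mult_distrib)
  finally show False
    using far unfolding e_def exp_half_diff by (simp add: power_mult_distrib algebra_simps)
qed

lemma length_space_short_path:
  assumes "length_space S" "x \<in> S" "y \<in> S" "dist x y < r"
  obtains g where "path g" "path_image g \<subseteq> S" "pathstart g = x" "pathfinish g = y" "curve_length g < ereal r"
proof -
  have "(INF g \<in> {g. path g \<and> path_image g \<subseteq> S \<and> pathstart g = x \<and> pathfinish g = y}. curve_length g)
      = ereal (dist x y)"
    using assms(1-3) unfolding length_space_def by simp
  also have "\<dots> < ereal r" using assms(4) by simp
  finally have "(INF g \<in> {g. path g \<and> path_image g \<subseteq> S \<and> pathstart g = x \<and> pathfinish g = y}. curve_length g)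
      < ereal r" .
  then show ?thesis using that by (auto simp: INF_less_iff)
qed

text \<open>Paths from a common point of the collars to both geodesics miss all separating geodesics, and their
union is a connected set that meets both components.\<close>

lemma separated_collars_disjoint:
  assumes ls: "length_space S" and uc: "universal_cover S \<pi>" and ori: "orientable_surface S"
    and \<omega>: "closed_geodesic S \<omega>1 l1" "closed_geodesic S \<omega>2 l2"
    and sep: "separated_by_simple_geodesics S \<omega>1 \<omega>2"
  shows "nbhd S dist (collar_width (l1 / 2)) (range \<omega>1) \<inter> nbhd S dist (collar_width (l2 / 2)) (range \<omega>2) = {}"
proof (rule ccontr)
  assume "\<not> ?thesis"
  then obtain x s t where x: "x \<in> S" "dist x (\<omega>1 s) < collar_width (l1 / 2)" "dist x (\<omega>2 t) < collar_width (l2 / 2)"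
    unfolding nbhd_def by blast
  obtain \<Gamma> where \<Gamma>: "\<forall>C\<in>\<Gamma>. \<exists>\<gamma> l. simple_closed_geodesic S \<gamma> l \<and> C = range \<gamma>"
    and ex: "\<exists>C1\<in>components (S - \<Union>\<Gamma>). \<exists>C2\<in>components (S - \<Union>\<Gamma>).
      C1 \<noteq> C2 \<and> range \<omega>1 \<subseteq> C1 \<and> range \<omega>2 \<subseteq> C2"
    using sep unfolding separated_by_simple_geodesics_def by (elim exE conjE) (rule that, assumption+)
  obtain C1 C2 where C: "C1 \<in> components (S - \<Union>\<Gamma>)" "C2 \<in> components (S - \<Union>\<Gamma>)" "C1 \<noteq> C2" "range \<omega>1 \<subseteq> C1" "range \<omega>2 \<subseteq> C2"
    using ex by (elim bexE conjE) (rule that, assumption+)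
  have in_S: "\<omega>1 s \<in> S" "\<omega>2 t \<in> S" using \<omega> by (auto simp: closed_geodesic_def)
  obtain g1 where g1: "path g1" "path_image g1 \<subseteq> S" "pathstart g1 = \<omega>1 s" "pathfinish g1 = x"
    "curve_length g1 < ereal (collar_width (l1 / 2))"
    using length_space_short_path[OF ls in_S(1) x(1)] x(2) by (metis dist_commute)
  obtain g2 where g2: "path g2" "path_image g2 \<subseteq> S" "pathstart g2 = \<omega>2 t" "pathfinish g2 = x"
    "curve_length g2 < ereal (collar_width (l2 / 2))"
    using length_space_short_path[OF ls in_S(2) x(1)] x(3) by (metis dist_commute)
  have sub: "C1 \<subseteq> S - \<Union>\<Gamma>" "C2 \<subseteq> S - \<Union>\<Gamma>" using C in_components_subset by blast+
  have avoid: "path_image g1 \<inter> \<Union>\<Gamma> = {}" "path_image g2 \<inter> \<Union>\<Gamma> = {}"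
  proof -
    have "path_image g1 \<inter> K = {} \<and> path_image g2 \<inter> K = {}" if K: "K \<in> \<Gamma>" for K
    proof -
      obtain \<gamma> l where \<gamma>: "simple_closed_geodesic S \<gamma> l" "K = range \<gamma>" using bspec[OF \<Gamma> K] by blast
      have "range \<omega>1 \<inter> range \<gamma> = {}" "range \<omega>2 \<inter> range \<gamma> = {}" using \<gamma>(2) K C(4,5) sub by blast+
      then show ?thesis
        using short_path_avoids_simple_geodesic[OF uc ori \<omega>(1) \<gamma>(1) _ g1(1,2) _ g1(5)]
          short_path_avoids_simple_geodesic[OF uc ori \<omega>(2) \<gamma>(1) _ g2(1,2) _ g2(5)] g1(3) g2(3) \<gamma>(2) by auto
    qed
    then show "path_image g1 \<inter> \<Union>\<Gamma> = {}" "path_image g2 \<inter> \<Union>\<Gamma> = {}" by blast+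
  qed
  have inX: "path_image g1 \<union> path_image g2 \<subseteq> S - \<Union>\<Gamma>"
    using avoid g1(2) g2(2) by (simp only: Un_subset_iff Diff_eq Int_subset_iff disjoint_eq_subset_Compl)
  have "x \<in> path_image g1" "x \<in> path_image g2"
    using pathfinish_in_path_image[of g1] pathfinish_in_path_image[of g2] g1(4) g2(4) by simp_all
  then have conn: "connected (path_image g1 \<union> path_image g2)"
    using g1(1) g2(1) by (intro connected_Un connected_path_image) auto
  have ends: "\<omega>1 s \<in> path_image g1" "\<omega>2 t \<in> path_image g2"
    using pathstart_in_path_image[of g1] pathstart_in_path_image[of g2] g1(3) g2(3) by simp_all
  have "\<omega>1 s \<in> C1" "\<omega>2 t \<in> C2" using C(4,5) by auto
  then have "path_image g1 \<union> path_image g2 \<subseteq> C1" "path_image g1 \<union> path_image g2 \<subseteq> C2"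
    using components_maximal[OF C(1) conn inX] components_maximal[OF C(2) conn inX] ends by blast+
  then have "C1 \<inter> C2 \<noteq> {}" using ends(1) by blast
  then show False using components_nonoverlap[OF C(1,2)] C(3) by blast
qed

theorem theorem1:
  fixes S :: "'a::metric_space set" and \<pi> :: "complex \<Rightarrow> 'a"
  assumes "hyperbolic_surface S" and "orientable_surface S"
    and "universal_cover S \<pi>"
  shows "(\<forall>\<omega> l. closed_geodesic S \<omega> l \<longrightarrow> stable_nbhd \<pi> \<omega> (collar_width (l / 2))) \<and>
    (\<forall>\<omega>1 \<omega>2 l1 l2.
       closed_geodesic S \<omega>1 l1 \<and> closed_geodesic S \<omega>2 l2 \<and>
       range \<omega>1 \<inter> range \<omega>2 = {} \<and> separated_by_simple_geodesics S \<omega>1 \<omega>2 \<longrightarrow>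
       nbhd S dist (collar_width (l1 / 2)) (range \<omega>1) \<inter>
       nbhd S dist (collar_width (l2 / 2)) (range \<omega>2) = {})"
proof -
  have "length_space S" using assms(1) by (simp add: hyperbolic_surface_def)
  then show ?thesis
    using closed_geodesic_stable[OF assms(3,2)] separated_collars_disjoint[OF _ assms(3,2)] by blast
qed

end
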